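(* Let $G$ be an abelian group of odd (finite) order and let $T(G)$ be its Takasaki quandle, i.e. the set $G$ with the operation $a*b=2b-a$. Then there is an isomorphism of abelian groups $$H_2^Q(T(G))\cong G\wedge G,$$ where $H_2^Q$ denotes the second quandle homology group (with integer coefficients) and $G\wedge G$ is the exterior square of $G$. In particular, for $G=\mathbb{Z}_k^n$ with $k$ an odd positive integer and $n\ge 1$, $$H_2^Q(T(\mathbb{Z}_k^n))\cong \mathbb{Z}_k^{\binom{n}{2}}.$$
   Context: A quandle is a set $Q$ with a binary operation $*$ such that $a*a=a$ for all $a$; for each $b$ the map $a\mapsto a*b$ is a bijection of $Q$; and $(a*b)*c=(a*c)*(b*c)$ for all $a,b,c$. Quandle homology: for $n\ge 1$ let $C_n^R(Q)=\mathbb{Z}(Q^n)$ be the free abelian group on $n$-tuples of elements of $Q$, with boundary $\partial_n\colon C_n^R(Q)\to C_{n-1}^R(Q)$ given by $$\partial_n(x_1,\dots,x_n)=\sum_{i=2}^n(-1)^i\big[(x_1,\dots,x_{i-1},x_{i+1},\dots,x_n)-(x_1*x_i,\dots,x_{i-1}*x_i,x_{i+1},\dots,x_n)\big].$$ Let $C_n^D(Q)\subseteq C_n^R(Q)$ be the subgroup generated by tuples with $x_i=x_{i+1}$ for some $i$ (and $C_1^D(Q)=0$); it is a subcomplex. Set $C_n^Q(Q)=C_n^R(Q)/C_n^D(Q)$, with the induced boundary maps. Explicitly, $\partial_2(a,b)=a-a*b$ and $\partial_3(a,b,c)=(a,c)+(a*c,b*c)-(a,b)-(a*b,c)$. Then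 $H_2^Q(Q)=\ker(\partial_2\colon C_2^Q(Q)\to C_1^Q(Q))/\operatorname{im}(\partial_3\colon C_3^Q(Q)\to C_2^Q(Q))$. The exterior square $G\wedge G$ of an abelian group $G$ is the quotient of $G\otimes_{\mathbb{Z}}G$ by the subgroup generated by all $x\otimes x$, $x\in G$. $\mathbb{Z}_k$ denotes the cyclic group $\mathbb{Z}/k\mathbb{Z}$. *)

theory Defs
  imports "HOL-Algebra.Free_Abelian_Groups"
begin

section \<open>Quandles\<close>

record 'a quandle_struct = "'a partial_object" +
  qop :: "'a \<Rightarrow> 'a \<Rightarrow> 'a" (infixl \<open>\<triangleright>\<index>\<close> 70)

locale quandle =
  fixes Q (structure)
  assumes idem: "a \<in> carrier Q \<Longrightarrow> a \<triangleright> a = a"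
    and bij: "b \<in> carrier Q \<Longrightarrow> bij_betw (\<lambda>a. a \<triangleright> b) (carrier Q) (carrier Q)"
    and distrib: "\<lbrakk>a \<in> carrier Q; b \<in> carrier Q; c \<in> carrier Q\<rbrakk>
                   \<Longrightarrow> (a \<triangleright> b) \<triangleright> c = (a \<triangleright> c) \<triangleright> (b \<triangleright> c)"

text \<open>The operation \<open>a * b = 2 b - a\<close>, in the multiplicative notation of \<open>HOL-Algebra\<close>.\<close>

definition takasaki :: "('a, 'b) monoid_scheme \<Rightarrow> 'a quandle_struct"
  where "takasaki G =
    \<lparr>carrier = carrier G, qop = (\<lambda>a b. b [^]\<^bsub>G\<^esub> (2::nat) \<otimes>\<^bsub>G\<^esub> inv\<^bsub>G\<^esub> a)\<rparr>"

section \<open>Quandle homology\<close>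

definition tuples :: "('a, 'b) quandle_struct_scheme \<Rightarrow> nat \<Rightarrow> 'a list set"
  where "tuples Q n = {xs. length xs = n \<and> set xs \<subseteq> carrier Q}"

definition rack_chain_group :: "('a, 'b) quandle_struct_scheme \<Rightarrow> nat \<Rightarrow> ('a list \<Rightarrow>\<^sub>0 int) monoid"
  where "rack_chain_group Q n = free_Abelian_group (tuples Q n)"

text \<open>The index \<open>i\<close> runs through the 1-based positions \<open>2, \<dots>, n\<close> of an \<open>n\<close>-tuple;
  lists are 0-based, so the entry in position \<open>i\<close> is \<open>xs ! (i - 1)\<close>. The map is extended
  linearly, simultaneously for all \<open>n\<close>.\<close>

definition rack_boundary ::
    "('a, 'b) quandle_struct_scheme \<Rightarrow> ('a list \<Rightarrow>\<^sub>0 int) \<Rightarrow> ('a list \<Rightarrow>\<^sub>0 int)"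
  where "rack_boundary Q = frag_extend (\<lambda>xs. \<Sum>i = 2..length xs. frag_cmul ((-1) ^ i)
    (frag_of (take (i - 1) xs @ drop i xs)
     - frag_of (map (\<lambda>x. x \<triangleright>\<^bsub>Q\<^esub> (xs ! (i - 1))) (take (i - 1) xs) @ drop i xs)))"

definition degenerate_chains :: "('a, 'b) quandle_struct_scheme \<Rightarrow> nat \<Rightarrow> ('a list \<Rightarrow>\<^sub>0 int) set"
  where "degenerate_chains Q n = generate (rack_chain_group Q n)
    {frag_of xs | xs. xs \<in> tuples Q n \<and> (\<exists>i. Suc i < n \<and> xs ! i = xs ! Suc i)}"

definition quandle_chain_group ::
    "('a, 'b) quandle_struct_scheme \<Rightarrow> nat \<Rightarrow> ('a list \<Rightarrow>\<^sub>0 int) set monoid"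
  where "quandle_chain_group Q n = rack_chain_group Q n Mod degenerate_chains Q n"

text \<open>The induced map \<open>C\<^sub>n / D\<^sub>n \<rightarrow> C\<^sub>n\<^sub>-\<^sub>1 / D\<^sub>n\<^sub>-\<^sub>1\<close> on cosets.\<close>

definition quandle_boundary ::
    "('a, 'b) quandle_struct_scheme \<Rightarrow> nat \<Rightarrow> ('a list \<Rightarrow>\<^sub>0 int) set \<Rightarrow> ('a list \<Rightarrow>\<^sub>0 int) set"
  where "quandle_boundary Q n A = the_elem
    ((\<lambda>c. degenerate_chains Q (n - 1) #>\<^bsub>rack_chain_group Q (n - 1)\<^esub> rack_boundary Q c) ` A)"

definition quandle_cycle_group ::
    "('a, 'b) quandle_struct_scheme \<Rightarrow> nat \<Rightarrow> ('a list \<Rightarrow>\<^sub>0 int) set monoid"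
  where "quandle_cycle_group Q n = subgroup_generated (quandle_chain_group Q n)
    (kernel (quandle_chain_group Q n) (quandle_chain_group Q (n - 1)) (quandle_boundary Q n))"

definition quandle_homology ::
    "nat \<Rightarrow> ('a, 'b) quandle_struct_scheme \<Rightarrow> ('a list \<Rightarrow>\<^sub>0 int) set set monoid"
  where "quandle_homology n Q = quandle_cycle_group Q n
    Mod (quandle_boundary Q (n + 1) ` carrier (quandle_chain_group Q (n + 1)))"

section \<open>Tensor product over the integers and exterior square\<close>

definition bilinear_relations ::
    "('a, 'c) monoid_scheme \<Rightarrow> ('b, 'd) monoid_scheme \<Rightarrow> ('a \<times> 'b \<Rightarrow>\<^sub>0 int) set"
  where "bilinear_relations G H =
    {frag_of (x \<otimes>\<^bsub>G\<^esub> x', y) - frag_of (x, y) - frag_of (x', y) | x x' y.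
       x \<in> carrier G \<and> x' \<in> carrier G \<and> y \<in> carrier H} \<union>
    {frag_of (x, y \<otimes>\<^bsub>H\<^esub> y') - frag_of (x, y) - frag_of (x, y') | x y y'.
       x \<in> carrier G \<and> y \<in> carrier H \<and> y' \<in> carrier H}"

definition tensor_relations ::
    "('a, 'c) monoid_scheme \<Rightarrow> ('b, 'd) monoid_scheme \<Rightarrow> ('a \<times> 'b \<Rightarrow>\<^sub>0 int) set"
  where "tensor_relations G H =
    generate (free_Abelian_group (carrier G \<times> carrier H)) (bilinear_relations G H)"

definition tensor_product ::
    "('a, 'c) monoid_scheme \<Rightarrow> ('b, 'd) monoid_scheme \<Rightarrow> ('a \<times> 'b \<Rightarrow>\<^sub>0 int) set monoid"
  where "tensor_product G H =
    free_Abelian_group (carrier G \<times> carrier H) Mod tensor_relations G H"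

definition pure_tensor ::
    "('a, 'c) monoid_scheme \<Rightarrow> ('b, 'd) monoid_scheme \<Rightarrow> 'a \<Rightarrow> 'b \<Rightarrow> ('a \<times> 'b \<Rightarrow>\<^sub>0 int) set"
  where "pure_tensor G H x y =
    tensor_relations G H #>\<^bsub>free_Abelian_group (carrier G \<times> carrier H)\<^esub> frag_of (x, y)"

definition exterior_square ::
    "('a, 'b) monoid_scheme \<Rightarrow> ('a \<times> 'a \<Rightarrow>\<^sub>0 int) set set monoid"
  where "exterior_square G = tensor_product G G
    Mod generate (tensor_product G G) {pure_tensor G G x x | x. x \<in> carrier G}"

section \<open>Powers of a cyclic group\<close>

definition cyclic_power :: "nat \<Rightarrow> nat \<Rightarrow> (nat \<Rightarrow> int) monoid"
  where "cyclic_power k n = product_group {..<n} (\<lambda>_. integer_mod_group k)"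

section \<open>Well-definedness\<close>

text \<open>The formulas for the boundary, the induced maps and the inclusion of boundaries in
  cycles are checked in the degrees that enter \<open>H\<^sub>2\<close>.\<close>

lemma (in comm_group) normal_generate:
  "S \<subseteq> carrier G \<Longrightarrow> generate G S \<lhd> G"
  by (simp add: generate_is_subgroup normal_iff_subgroup)

lemma (in comm_group) comm_group_Mod_generate:
  "S \<subseteq> carrier G \<Longrightarrow> comm_group (G Mod generate G S)"
  by (simp add: abelian_FactGroup generate_is_subgroup)

lemma comm_group_tensor_product:
  assumes "comm_group G" "comm_group H"
  shows "comm_group (tensor_product G H)"
proof -
  interpret G: comm_group G by fact
  interpret H: comm_group H by fact
  interpret F: comm_group "free_Abelian_group (carrier G \<times> carrier H)"
    by (rule abelian_free_Abelian_group)
  have "bilinear_relations G H \<subseteq> carrier (free_Abelian_group (carrier G \<times> carrier H))"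
    unfolding bilinear_relations_def
    by (auto dest!: keys_diff [THEN subsetD])
  then show ?thesis
    unfolding tensor_product_def tensor_relations_def by (rule F.comm_group_Mod_generate)
qed

lemma comm_group_exterior_square:
  assumes "comm_group G"
  shows "comm_group (exterior_square G)"
proof -
  interpret T: comm_group "tensor_product G G"
    using assms by (intro comm_group_tensor_product)
  have "{pure_tensor G G x x | x. x \<in> carrier G} \<subseteq> carrier (tensor_product G G)"
    by (auto simp: pure_tensor_def tensor_product_def carrier_FactGroup)
  then show ?thesis
    unfolding exterior_square_def by (rule T.comm_group_Mod_generate)
qed

lemma comm_group_cyclic_power: "comm_group (cyclic_power k n)"
proof -
  interpret Z: comm_group "integer_mod_group k" by simp
  interpret P: group "cyclic_power k n" by (simp add: cyclic_power_def)
  show ?thesis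
    by (rule P.group_comm_groupI)
      (auto simp: cyclic_power_def fun_eq_iff PiE_iff add.commute)
qed

lemma order_cyclic_power: "k > 0 \<Longrightarrow> order (cyclic_power k n) = k ^ n"
  by (simp add: order_def cyclic_power_def card_PiE carrier_integer_mod_group)

lemma quandle_takasaki:
  fixes G (structure)
  assumes "comm_group G"
  shows "quandle (takasaki G)"
proof -
  interpret comm_group G by fact
  have sq: "x [^] (2::nat) = x \<otimes> x" if "x \<in> carrier G" for x
    using that by (simp add: numeral_2_eq_2)
  show ?thesis
  proof
    fix b assume b: "b \<in> carrier (takasaki G)"
    then have "b \<otimes> b \<otimes> inv (b \<otimes> b \<otimes> inv a) = a" if "a \<in> carrier G" for a
      using that by (simp add: takasaki_def inv_mult_group m_assoc [symmetric])
        (simp add: m_ac)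
    then show "bij_betw (\<lambda>a. a \<triangleright>\<^bsub>takasaki G\<^esub> b) (carrier (takasaki G)) (carrier (takasaki G))"
      using b by (intro bij_betw_byWitness [where f' = "\<lambda>a. b \<otimes> b \<otimes> inv a"])
        (auto simp: takasaki_def sq)
  next
    fix a b c
    assume "a \<in> carrier (takasaki G)" "b \<in> carrier (takasaki G)" "c \<in> carrier (takasaki G)"
    then have mem: "a \<in> carrier G" "b \<in> carrier G" "c \<in> carrier G" by (simp_all add: takasaki_def)
    have ac: "(d \<otimes> b') \<otimes> (d \<otimes> b') \<otimes> (a \<otimes> d') = (d \<otimes> d') \<otimes> (d \<otimes> (a \<otimes> (b' \<otimes> b')))"
      if "d \<in> carrier G" "d' \<in> carrier G" "b' \<in> carrier G" for d d' b'
      using that mem by (simp add: m_ac)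
    have "(c \<otimes> c \<otimes> inv b) \<otimes> (c \<otimes> c \<otimes> inv b) \<otimes> inv (c \<otimes> c \<otimes> inv a)
        = (c \<otimes> c \<otimes> inv b) \<otimes> (c \<otimes> c \<otimes> inv b) \<otimes> (a \<otimes> inv (c \<otimes> c))"
      using mem inv_mult_group [of "c \<otimes> c" "inv a"] by simp
    also have "\<dots> = c \<otimes> c \<otimes> (a \<otimes> (inv b \<otimes> inv b))"
      using mem ac [of "c \<otimes> c" "inv (c \<otimes> c)" "inv b"] r_inv [of "c \<otimes> c"] by simp
    also have "\<dots> = c \<otimes> c \<otimes> inv (b \<otimes> b \<otimes> inv a)"
      using mem inv_mult_group [of "b \<otimes> b" "inv a"] inv_mult_group [of b b] by simp
    finally show "(a \<triangleright>\<^bsub>takasaki G\<^esub> b) \<triangleright>\<^bsub>takasaki G\<^esub> c =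
        (a \<triangleright>\<^bsub>takasaki G\<^esub> c) \<triangleright>\<^bsub>takasaki G\<^esub> (b \<triangleright>\<^bsub>takasaki G\<^esub> c)"
      using mem by (simp add: takasaki_def sq)
  qed (auto simp: takasaki_def sq m_assoc)
qed

lemma rack_boundary_2:
  "rack_boundary Q (frag_of [a, b]) = frag_of [a] - frag_of [a \<triangleright>\<^bsub>Q\<^esub> b]"
proof -
  have "{2..2::nat} = {2}" by auto
  then show ?thesis by (simp add: rack_boundary_def)
qed

lemma rack_boundary_3:
  "rack_boundary Q (frag_of [a, b, c]) =
    frag_of [a, c] + frag_of [a \<triangleright>\<^bsub>Q\<^esub> c, b \<triangleright>\<^bsub>Q\<^esub> c] - frag_of [a, b] - frag_of [a \<triangleright>\<^bsub>Q\<^esub> b, c]"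
proof -
  have "{2..3::nat} = {2, 3}" by auto
  then show ?thesis by (simp add: rack_boundary_def)
qed

lemma carrier_rack_chain_group:
  "c \<in> carrier (rack_chain_group Q n) \<longleftrightarrow> Poly_Mapping.keys c \<subseteq> tuples Q n"
  by (simp add: rack_chain_group_def)

lemma comm_group_rack_chain_group: "comm_group (rack_chain_group Q n)"
  by (simp add: rack_chain_group_def abelian_free_Abelian_group)

lemma degenerate_chains_normal: "degenerate_chains Q n \<lhd> rack_chain_group Q n"
  unfolding degenerate_chains_def
  by (rule comm_group.normal_generate [OF comm_group_rack_chain_group])
    (auto simp: carrier_rack_chain_group)

lemma comm_group_quandle_chain_group: "comm_group (quandle_chain_group Q n)"
  unfolding quandle_chain_group_def
  by (intro comm_group.abelian_FactGroup comm_group_rack_chain_group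
      normal_imp_subgroup degenerate_chains_normal)

lemma (in quandle) qop_closed:
  "a \<in> carrier Q \<Longrightarrow> b \<in> carrier Q \<Longrightarrow> a \<triangleright> b \<in> carrier Q"
  using bij bij_betwE by fastforce

lemma (in quandle) rack_boundary_hom:
  "rack_boundary Q \<in> hom (rack_chain_group Q n) (rack_chain_group Q (n - 1))"
proof -
  have "frag_cmul m (frag_of (take (i - 1) xs @ drop i xs)
      - frag_of (map (\<lambda>x. x \<triangleright> (xs ! (i - 1))) (take (i - 1) xs) @ drop i xs))
     \<in> carrier (free_Abelian_group (tuples Q (n - 1)))"
    if xs: "length xs = n" "set xs \<subseteq> carrier Q" and i: "i \<in> {2..n}" for xs i m
  proof -
    have "xs ! (i - 1) \<in> carrier Q"
      using xs i by (metis Suc_pred' atLeastAtMost_iff less_eq_Suc_le nth_mem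
          not_numeral_le_zero order.trans subsetD zero_less_iff_neq_zero)
    then have "take (i - 1) xs @ drop i xs \<in> tuples Q (n - 1)"
      "map (\<lambda>x. x \<triangleright> (xs ! (i - 1))) (take (i - 1) xs) @ drop i xs \<in> tuples Q (n - 1)"
      using xs i by (auto simp: tuples_def qop_closed dest!: in_set_takeD in_set_dropD)
    then show ?thesis
      using keys_cmul keys_diff by fastforce
  qed
  then have gen: "Poly_Mapping.keys (rack_boundary Q (frag_of xs)) \<subseteq> tuples Q (n - 1)"
    if "xs \<in> tuples Q n" for xs
    unfolding rack_boundary_def frag_extend_of carrier_free_Abelian_group_iff [symmetric]
    by (intro sum_closed_free_Abelian_group) (use that in \<open>auto simp: tuples_def\<close>)
  have "rack_boundary Q c \<in> carrier (rack_chain_group Q (n - 1))"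
    if "c \<in> carrier (rack_chain_group Q n)" for c
    unfolding carrier_rack_chain_group rack_boundary_def
    by (intro order.trans [OF keys_frag_extend] UN_least gen [unfolded rack_boundary_def frag_extend_of])
      (use that in \<open>auto simp: carrier_rack_chain_group\<close>)
  then show ?thesis
    by (auto simp: hom_def rack_boundary_def frag_extend_add rack_chain_group_def)
qed

lemma hom_generate_subset:
  assumes "f \<in> hom G H" "group G" "S \<subseteq> carrier G" "subgroup K H" "group H" "f ` S \<subseteq> K"
  shows "f ` generate G S \<subseteq> K"
proof -
  interpret group_hom G H f
    using assms by (simp add: group_hom_def group_hom_axioms_def)
  show ?thesis
    using generate_img [OF assms(3)] H.generate_subgroup_incl [OF assms(6,4)] by simp
qed

lemma (in quandle) rack_boundary_degenerate:
  assumes "n \<in> {2, 3}"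
  shows "rack_boundary Q ` degenerate_chains Q n \<subseteq> degenerate_chains Q (n - 1)"
  unfolding degenerate_chains_def [of _ n]
proof (rule hom_generate_subset [OF rack_boundary_hom])
  have sub: "subgroup (degenerate_chains Q m) (rack_chain_group Q m)" for m
    by (simp add: degenerate_chains_normal normal_imp_subgroup)
  show "subgroup (degenerate_chains Q (n - 1)) (rack_chain_group Q (n - 1))" by (rule sub)
  have zero: "0 \<in> degenerate_chains Q m" for m
    using subgroup.one_closed [OF sub [of m]] by (simp add: rack_chain_group_def)
  have gen: "frag_of [a, a] \<in> degenerate_chains Q 2" if "a \<in> carrier Q" for a
    unfolding degenerate_chains_def
    by (rule generate.incl) (use that in \<open>auto simp: tuples_def intro!: exI [of _ "[a, a]"]\<close>)
  have diff: "frag_of [a, a] - frag_of [b, b] \<in> degenerate_chains Q 2"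
    if "a \<in> carrier Q" "b \<in> carrier Q" for a b
    using subgroup.m_closed [OF sub gen [OF that(1)] subgroup.m_inv_closed [OF sub gen [OF that(2)]]]
      that by (simp add: rack_chain_group_def tuples_def)
  show "rack_boundary Q ` {frag_of xs | xs. xs \<in> tuples Q n \<and> (\<exists>i. Suc i < n \<and> xs ! i = xs ! Suc i)}
      \<subseteq> degenerate_chains Q (n - 1)"
  proof clarify
    fix xs i assume xs: "xs \<in> tuples Q n" and i: "Suc i < n" "xs ! i = xs ! Suc i"
    show "rack_boundary Q (frag_of xs) \<in> degenerate_chains Q (n - 1)"
    proof (cases "n = 2")
      case True
      then obtain a b where ab: "xs = [a, b]"
        using xs by (auto simp: tuples_def length_Suc_conv numeral_2_eq_2)
      with True i xs have "a = b" "a \<in> carrier Q" by (auto simp: tuples_def less_Suc_eq)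
      with ab zero show ?thesis by (simp add: rack_boundary_2 idem)
    next
      case False
      with assms have n: "n = 3" by simp
      then obtain a b c where abc: "xs = [a, b, c]"
        using xs by (auto simp: tuples_def length_Suc_conv numeral_3_eq_3)
      with n xs have mem: "a \<in> carrier Q" "b \<in> carrier Q" "c \<in> carrier Q"
        by (auto simp: tuples_def)
      from n i abc have "a = b \<or> b = c"
        by (auto simp: numeral_3_eq_3 less_Suc_eq)
      then show ?thesis
      proof
        assume "a = b"
        with abc n mem diff [of "a \<triangleright> c" a] show ?thesis
          by (simp add: rack_boundary_3 idem qop_closed)
      next
        assume "b = c"
        with abc n mem zero show ?thesis by (simp add: rack_boundary_3 idem)
      qed
    qed
  qed
qed (auto simp: carrier_rack_chain_group comm_group.axioms(2) comm_group_rack_chain_group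
    simp del: One_nat_def)

lemma (in quandle) quandle_boundary_coset:
  assumes n: "n \<in> {2, 3}" and c: "c \<in> carrier (rack_chain_group Q n)"
  shows "quandle_boundary Q n (degenerate_chains Q n #>\<^bsub>rack_chain_group Q n\<^esub> c) =
    degenerate_chains Q (n - 1) #>\<^bsub>rack_chain_group Q (n - 1)\<^esub> rack_boundary Q c"
proof -
  let ?C = "rack_chain_group Q n" and ?C' = "rack_chain_group Q (n - 1)"
  let ?D = "degenerate_chains Q n" and ?D' = "degenerate_chains Q (n - 1)"
  interpret C: comm_group ?C by (rule comm_group_rack_chain_group)
  interpret C': comm_group ?C' by (rule comm_group_rack_chain_group)
  interpret D: normal ?D ?C by (rule degenerate_chains_normal)
  interpret D': normal ?D' ?C' by (rule degenerate_chains_normal)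
  interpret h: group_hom ?C ?C' "rack_boundary Q"
    by unfold_locales (rule rack_boundary_hom)
  have "?D' #>\<^bsub>?C'\<^esub> rack_boundary Q x = ?D' #>\<^bsub>?C'\<^esub> rack_boundary Q c"
    if x: "x \<in> ?D #>\<^bsub>?C\<^esub> c" for x
  proof -
    from x obtain d where d: "d \<in> ?D" "x = d \<otimes>\<^bsub>?C\<^esub> c" by (auto simp: r_coset_def)
    have "rack_boundary Q d \<in> ?D'" using rack_boundary_degenerate [OF n] d by auto
    moreover have "rack_boundary Q x = rack_boundary Q d \<otimes>\<^bsub>?C'\<^esub> rack_boundary Q c"
      using d c by (simp add: D.mem_carrier)
    ultimately show ?thesis
      using c C'.coset_mult_assoc [OF D'.subset D'.mem_carrier h.hom_closed, of "rack_boundary Q d" c]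
        C'.coset_join2 [OF D'.mem_carrier D'.subgroup_axioms] by simp
  qed
  moreover have "c \<in> ?D #>\<^bsub>?C\<^esub> c"
    using C.rcos_self [OF c D.subgroup_axioms] .
  ultimately have "(\<lambda>x. ?D' #>\<^bsub>?C'\<^esub> rack_boundary Q x) ` (?D #>\<^bsub>?C\<^esub> c)
      = {?D' #>\<^bsub>?C'\<^esub> rack_boundary Q c}" by blast
  then show ?thesis by (simp add: quandle_boundary_def)
qed

lemma (in quandle) quandle_boundary_hom:
  assumes n: "n \<in> {2, 3}"
  shows "quandle_boundary Q n \<in> hom (quandle_chain_group Q n) (quandle_chain_group Q (n - 1))"
proof -
  let ?C = "rack_chain_group Q n" and ?C' = "rack_chain_group Q (n - 1)"
  interpret C: comm_group ?C by (rule comm_group_rack_chain_group)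
  interpret D: normal "degenerate_chains Q n" ?C by (rule degenerate_chains_normal)
  interpret D': normal "degenerate_chains Q (n - 1)" ?C' by (rule degenerate_chains_normal)
  note hom = rack_boundary_hom [of n]
  show ?thesis
  proof (rule homI)
    fix A assume "A \<in> carrier (quandle_chain_group Q n)"
    then show "quandle_boundary Q n A \<in> carrier (quandle_chain_group Q (n - 1))"
      using hom_in_carrier [OF hom]
      by (auto simp: quandle_chain_group_def carrier_FactGroup quandle_boundary_coset [OF n])
  next
    fix A B assume "A \<in> carrier (quandle_chain_group Q n)" "B \<in> carrier (quandle_chain_group Q n)"
    then show "quandle_boundary Q n (A \<otimes>\<^bsub>quandle_chain_group Q n\<^esub> B)
        = quandle_boundary Q n A \<otimes>\<^bsub>quandle_chain_group Q (n - 1)\<^esub> quandle_boundary Q n B"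
      using hom_in_carrier [OF hom] hom_mult [OF hom]
      by (auto simp: quandle_chain_group_def carrier_FactGroup quandle_boundary_coset [OF n]
          D.rcos_sum D'.rcos_sum simp del: One_nat_def)
  qed
qed

lemma (in quandle) rack_boundary_rack_boundary:
  assumes "c \<in> carrier (rack_chain_group Q 3)"
  shows "rack_boundary Q (rack_boundary Q c) = 0"
proof -
  have "Poly_Mapping.keys c \<subseteq> tuples Q 3" using assms by (simp add: carrier_rack_chain_group)
  then show ?thesis
  proof (induction c rule: frag_induction)
    case (one xs)
    then obtain a b c where abc: "xs = [a, b, c]" "a \<in> carrier Q" "b \<in> carrier Q" "c \<in> carrier Q"
      by (auto simp: tuples_def length_Suc_conv numeral_3_eq_3)
    then have "rack_boundary Q (rack_boundary Q (frag_of xs)) =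
        rack_boundary Q (frag_of [a, c]) + rack_boundary Q (frag_of [a \<triangleright> c, b \<triangleright> c])
        - rack_boundary Q (frag_of [a, b]) - rack_boundary Q (frag_of [a \<triangleright> b, c])"
      unfolding abc rack_boundary_3 by (simp add: rack_boundary_def frag_extend_add frag_extend_diff)
    with abc show ?case by (simp add: rack_boundary_2 distrib)
  qed (simp_all add: rack_boundary_def frag_extend_diff)
qed

lemma (in quandle) comm_group_quandle_homology_2: "comm_group (quandle_homology 2 Q)"
proof -
  let ?C1 = "quandle_chain_group Q 1" and ?C2 = "quandle_chain_group Q 2"
    and ?C3 = "quandle_chain_group Q 3"
  let ?K = "kernel ?C2 ?C1 (quandle_boundary Q 2)"
  let ?B = "quandle_boundary Q 3 ` carrier ?C3"
  interpret C1: comm_group ?C1 by (rule comm_group_quandle_chain_group)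
  interpret C2: comm_group ?C2 by (rule comm_group_quandle_chain_group)
  interpret C3: comm_group ?C3 by (rule comm_group_quandle_chain_group)
  interpret h2: group_hom ?C2 ?C1 "quandle_boundary Q 2"
    using quandle_boundary_hom [of 2] by unfold_locales simp
  interpret h3: group_hom ?C3 ?C2 "quandle_boundary Q 3"
    using quandle_boundary_hom [of 3] by unfold_locales simp
  have B: "subgroup ?B ?C2" by (rule h3.img_is_subgroup)
  have "?B \<subseteq> ?K"
  proof clarify
    fix A assume A: "A \<in> carrier ?C3"
    then obtain c where c: "c \<in> carrier (rack_chain_group Q 3)"
      "A = degenerate_chains Q 3 #>\<^bsub>rack_chain_group Q 3\<^esub> c"
      by (auto simp: quandle_chain_group_def carrier_FactGroup)
    interpret D: normal "degenerate_chains Q 1" "rack_chain_group Q 1"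
      by (rule degenerate_chains_normal)
    have "degenerate_chains Q 1 #>\<^bsub>rack_chain_group Q 1\<^esub> 0 = \<one>\<^bsub>?C1\<^esub>"
      using D.coset_mult_one [OF D.subset]
      by (simp add: rack_chain_group_def quandle_chain_group_def)
    then have "quandle_boundary Q 2 (quandle_boundary Q 3 A) = \<one>\<^bsub>?C1\<^esub>"
      using c hom_in_carrier [OF rack_boundary_hom [of 3]]
        quandle_boundary_coset [of 3 c] quandle_boundary_coset [of 2 "rack_boundary Q c"]
        rack_boundary_rack_boundary [of c] by simp
    with A show "quandle_boundary Q 3 A \<in> ?K" by (simp add: kernel_def)
  qed
  moreover have Z: "comm_group (quandle_cycle_group Q 2)"
    using C2.abelian_subgroup_generated [OF C2.comm_group_axioms] by (simp add: quandle_cycle_group_def)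
  ultimately have "subgroup ?B (quandle_cycle_group Q 2)"
    using B C2.subgroup_of_subgroup_generated [of ?B ?K] by (simp add: quandle_cycle_group_def)
  with Z show ?thesis
    by (simp add: quandle_homology_def comm_group.abelian_FactGroup)
qed

end

theory Submission
  imports Defs "HOL-Algebra.Multiplicative_Group"
begin

text \<open>Write \<open>G\<close> additively, and let \<open>s(a, b)\<close> be a cocycle with \<open>s(a, a) = s(0, b) = 0\<close>. Each point
  \<open>b\<close> acts on \<open>G \<times> X\<close> by \<open>(a, x) \<mapsto> (2b - a, x + s(a, b))\<close>. A product of such maps that is trivial on
  \<open>G\<close> commutes with all of them, hence is translation by a constant of \<open>X\<close>, because \<open>T(G)\<close> is
  connected. So sending \<open>b\<close> to the action of \<open>0\<close> followed by that of \<open>b\<close> is a projective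
  representation of \<open>G\<close>, whose
  \<open>2\<close>-cocycle is \<open>h(b, c) = s(-2c, b)\<close>. It is alternating, so the commutator \<open>2h\<close> is bilinear, and
  \<open>h(2b, 2c) = 4h(b, c)\<close>; as every element of \<open>G\<close> is a double, \<open>h\<close> and then \<open>s\<close> are bilinear.
  Conversely every alternating bilinear map is such a cocycle, which identifies \<open>H\<^sub>2\<close> with the exterior
  square. For a power of a cyclic group, the \<open>2 \<times> 2\<close> minors are coordinates on the exterior square.\<close>

section \<open>Congruences modulo a subgroup\<close>

text \<open>A map into a quotient \<open>X / K\<close> is written as a map into \<open>X\<close>
  itself, and an identity between its values as membership in \<open>K\<close>. Cocycle calculations
  then need no cosets: an expression is rewritten as a signed sum of elements of
  \<open>K\<close>.\<close>

locale difference_closed =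
  fixes K :: "'x::ab_group_add set"
  assumes zero_mem: "0 \<in> K"
    and diff_mem: "x \<in> K \<Longrightarrow> y \<in> K \<Longrightarrow> x - y \<in> K"
begin

lemma add_mem: "x \<in> K \<Longrightarrow> y \<in> K \<Longrightarrow> x + y \<in> K"
  using diff_mem [of x "0 - y"] diff_mem [OF zero_mem] by simp

lemma uminus_mem: "x \<in> K \<Longrightarrow> - x \<in> K"
  using diff_mem [OF zero_mem] by fastforce

lemma sum_mem: "(\<And>i. i \<in> I \<Longrightarrow> f i \<in> K) \<Longrightarrow> sum f I \<in> K"
  by (induction I rule: infinite_finite_induct) (auto simp: zero_mem add_mem)

lemma diff_trans: "x - y \<in> K \<Longrightarrow> y - z \<in> K \<Longrightarrow> x - z \<in> K"
  using add_mem [of "x - y" "y - z"] by simp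

lemmas mem_intros = diff_mem add_mem

end

lemma difference_closed_subgroup:
  assumes "subgroup N (free_Abelian_group S)" shows "difference_closed N"
proof -
  interpret N: subgroup N "free_Abelian_group S" by fact
  show ?thesis
  proof
    fix x y assume xy: "x \<in> N" "y \<in> N"
    from N.m_closed [OF xy(1) N.m_inv_closed [OF xy(2)]] N.mem_carrier [OF xy(2)]
    show "x - y \<in> N" by simp
  qed (use N.one_closed in simp)
qed

lemma difference_closed_kernel:
  assumes "f \<in> hom (free_Abelian_group S) H" and "group H"
  shows "difference_closed (kernel (free_Abelian_group S) H f)"
  using assms
  by (intro difference_closed_subgroup [of _ S] group_hom.subgroup_kernel) (simp add: group_hom_def group_hom_axioms_def)

lemma subgroup_difference_closed:
  fixes K :: "('b \<Rightarrow>\<^sub>0 int) set"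
  assumes "difference_closed K"
  shows "subgroup K (free_Abelian_group UNIV)"
proof -
  interpret difference_closed K by fact
  show ?thesis
    using zero_mem by (intro group.subgroupI) (auto simp: add_mem uminus_mem)
qed

lemma frag_extend_hom: "frag_extend t \<in> hom (free_Abelian_group S) (free_Abelian_group UNIV)"
  by (auto simp: hom_def frag_extend_add)

lemma frag_cmul_mem:
  fixes K :: "('b \<Rightarrow>\<^sub>0 int) set"
  assumes "difference_closed K" and x: "x \<in> K"
  shows "frag_cmul m x \<in> K"
proof (induction m rule: int_induct [of _ 0])
  interpret difference_closed K by fact
  case base
  show ?case by (simp add: zero_mem)
next
  interpret difference_closed K by fact
  case (step1 i)
  then show ?case by (simp add: frag_cmul_distrib add_mem x)
next
  interpret difference_closed K by fact
  case (step2 i)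
  then show ?case by (simp add: frag_cmul_diff_distrib diff_mem x)
qed

section \<open>Alternating cocycles\<close>

context comm_group
begin

context
  fixes K :: "'x::ab_group_add set" and h :: "'a \<Rightarrow> 'a \<Rightarrow> 'x"
  assumes K: "difference_closed K"
    and cocycle: "\<And>a b c. \<lbrakk>a \<in> carrier G; b \<in> carrier G; c \<in> carrier G\<rbrakk>
      \<Longrightarrow> h a b + h (a \<otimes> b) c - h b c - h a (b \<otimes> c) \<in> K"
    and diag: "\<And>a. a \<in> carrier G \<Longrightarrow> h a a \<in> K"
    and antidiag: "\<And>a. a \<in> carrier G \<Longrightarrow> h a (inv a) \<in> K"
    and one_right: "\<And>a. a \<in> carrier G \<Longrightarrow> h a \<one> \<in> K"
    and even: "\<And>a b. \<lbrakk>a \<in> carrier G; b \<in> carrier G\<rbrakk> \<Longrightarrow> h (inv a) (inv b) - h a b \<in> K"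
begin

interpretation K: difference_closed K by (fact K)

text \<open>The cocycle identity at \<open>(b, c, inv c)\<close> gives
  \<open>h b c = - h (b \<otimes> c) (inv c)\<close> modulo \<open>K\<close>, and at
  \<open>(b \<otimes> c, inv c, inv b)\<close> it gives
  \<open>h (b \<otimes> c) (inv c) = h (inv c) (inv b)\<close>, which \<open>even\<close> turns into
  \<open>h c b\<close>.\<close>

lemma alternating_cocycle_antisym:
  assumes [simp]: "b \<in> carrier G" "c \<in> carrier G"
  shows "h b c + h c b \<in> K"
proof -
  have 1: "h b c + h (b \<otimes> c) (inv c) - h c (inv c) - h b \<one> \<in> K"
    using cocycle [of b c "inv c"] by simp
  have 2: "h (b \<otimes> c) (inv c) + h b (inv b) - h (inv c) (inv b) - h (b \<otimes> c) (inv (b \<otimes> c)) \<in> K"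
    using cocycle [of "b \<otimes> c" "inv c" "inv b"] by (simp add: m_assoc inv_mult_group)
  have "h b c + h c b =
      (h b c + h (b \<otimes> c) (inv c) - h c (inv c) - h b \<one>) + h c (inv c) + h b \<one>
      - (h (b \<otimes> c) (inv c) + h b (inv b) - h (inv c) (inv b) - h (b \<otimes> c) (inv (b \<otimes> c)))
      + h b (inv b) - h (b \<otimes> c) (inv (b \<otimes> c)) - (h (inv c) (inv b) - h c b)"
    by (simp add: algebra_simps)
  also have "\<dots> \<in> K"
    by (intro K.mem_intros 1 2 even antidiag one_right) simp_all
  finally show ?thesis .
qed

text \<open>The commutator pairing \<open>h x y - h y x\<close> of a 2-cocycle on an abelian group
  is bilinear, by an alternating sum of three cocycle identities. Antisymmetry makes it twice
  \<open>h\<close>. The factor 2 stays, since the quotient by \<open>K\<close> may have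
  2-torsion.\<close>

lemma alternating_cocycle_double_bilinear:
  assumes [simp]: "a \<in> carrier G" "b \<in> carrier G" "c \<in> carrier G"
  shows "(h (a \<otimes> b) c - h a c - h b c) + (h (a \<otimes> b) c - h a c - h b c) \<in> K"
proof -
  have "(h (a \<otimes> b) c - h a c - h b c) + (h (a \<otimes> b) c - h a c - h b c) =
      (h a b + h (a \<otimes> b) c - h b c - h a (b \<otimes> c))
      + (h c a + h (c \<otimes> a) b - h a b - h c (a \<otimes> b))
      - (h a c + h (a \<otimes> c) b - h c b - h a (c \<otimes> b))
      + (h (a \<otimes> b) c + h c (a \<otimes> b)) - (h a c + h c a) - (h b c + h c b)"
    by (simp add: algebra_simps m_comm [of c])
  also have "\<dots> \<in> K"
    by (intro K.mem_intros cocycle alternating_cocycle_antisym) simp_all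
  finally show ?thesis .
qed

text \<open>The cocycle identities at \<open>(b, b, c \<otimes> c)\<close>, \<open>(b, c, c)\<close>
  and \<open>(b, c, b \<otimes> c)\<close> reduce the left value to twice \<open>h b c\<close> plus
  twice \<open>h (b \<otimes> c) c\<close>. Only the doubled bilinearity is then required.\<close>

lemma alternating_cocycle_quadratic:
  assumes [simp]: "b \<in> carrier G" "c \<in> carrier G"
  shows "h (b \<otimes> b) (c \<otimes> c) - (h b c + h b c + h b c + h b c) \<in> K"
proof -
  have "h (b \<otimes> b) (c \<otimes> c) - (h b c + h b c + h b c + h b c) =
      (h b b + h (b \<otimes> b) (c \<otimes> c) - h b (c \<otimes> c) - h b (b \<otimes> (c \<otimes> c))) - h b b
      - (h b c + h (b \<otimes> c) c - h c c - h b (c \<otimes> c)) - h c c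
      - (h b c + h (b \<otimes> c) (b \<otimes> c) - h c (b \<otimes> c) - h b (c \<otimes> (b \<otimes> c))) + h (b \<otimes> c) (b \<otimes> c)
      - (h (b \<otimes> c) c + h c (b \<otimes> c))
      + ((h (b \<otimes> c) c - h b c - h c c) + (h (b \<otimes> c) c - h b c - h c c)) + h c c + h c c"
    by (simp add: algebra_simps m_lcomm [of c b])
  also have "\<dots> \<in> K"
    by (intro K.mem_intros cocycle alternating_cocycle_antisym diag
        alternating_cocycle_double_bilinear) simp_all
  finally show ?thesis .
qed

text \<open>On squares \<open>h\<close> is four times its value at the roots, so the defect of
  additivity is four times the defect at the roots. That is a sum of two doubled defects, which lie
  in \<open>K\<close>; nothing is divided by 2 in the values.\<close>

lemma alternating_cocycle_bilinear:
  assumes div: "\<And>a. a \<in> carrier G \<Longrightarrow> \<exists>b\<in>carrier G. a = b \<otimes> b"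
    and abc: "a \<in> carrier G" "b \<in> carrier G" "c \<in> carrier G"
  shows "h (a \<otimes> b) c - h a c - h b c \<in> K"
proof -
  from div abc obtain u v w where [simp]: "u \<in> carrier G" "v \<in> carrier G" "w \<in> carrier G"
    and eq: "a = u \<otimes> u" "b = v \<otimes> v" "c = w \<otimes> w" by metis
  have sq: "a \<otimes> b = (u \<otimes> v) \<otimes> (u \<otimes> v)" by (simp add: eq m_ac)
  let ?q = "\<lambda>x y. h (x \<otimes> x) (y \<otimes> y) - (h x y + h x y + h x y + h x y)"
  let ?d = "h (u \<otimes> v) w - h u w - h v w"
  have "h (a \<otimes> b) c - h a c - h b c = ?q (u \<otimes> v) w - ?q u w - ?q v w + (?d + ?d) + (?d + ?d)"
    unfolding sq unfolding eq by (simp add: algebra_simps)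
  also have "\<dots> \<in> K"
    by (intro K.add_mem [OF K.add_mem] K.diff_mem [OF K.diff_mem] alternating_cocycle_quadratic
        alternating_cocycle_double_bilinear) simp_all
  finally show ?thesis .
qed

end

end

section \<open>Quandle cocycles along words\<close>

text \<open>In the extension where a letter \<open>c\<close> acts by
  \<open>(a, x) \<mapsto> (q a c, x + s a c)\<close>, this is the second component reached from
  \<open>(a, 0)\<close> when the letters of the word act from left to right.\<close>

fun path_sum :: "('a \<Rightarrow> 'a \<Rightarrow> 'a) \<Rightarrow> ('a \<Rightarrow> 'a \<Rightarrow> 'x::ab_group_add) \<Rightarrow> 'a \<Rightarrow> 'a list \<Rightarrow> 'x"
  where "path_sum q s a [] = 0"
  | "path_sum q s a (c # w) = s a c + path_sum q s (q a c) w"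

text \<open>The cocycle condition says that acting by \<open>b\<close> and then \<open>c\<close>
  equals acting by \<open>c\<close> and then \<open>b \<triangleright> c\<close>, also on the second
  component of the extension. Repeating this moves \<open>b\<close> through the whole word and turns
  it into \<open>foldl (\<triangleright>) b w\<close>.\<close>

lemma (in quandle) path_sum_conjugate:
  assumes K: "difference_closed K"
    and s: "\<And>a b c. \<lbrakk>a \<in> carrier Q; b \<in> carrier Q; c \<in> carrier Q\<rbrakk>
      \<Longrightarrow> s a c + s (a \<triangleright> c) (b \<triangleright> c) - s a b - s (a \<triangleright> b) c \<in> K"
    and "a \<in> carrier Q" "b \<in> carrier Q" "set w \<subseteq> carrier Q"
  shows "s a b + path_sum (\<triangleright>) s (a \<triangleright> b) w
    - path_sum (\<triangleright>) s a w - s (foldl (\<triangleright>) a w) (foldl (\<triangleright>) b w) \<in> K"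
  using assms(3-)
proof (induction w arbitrary: a b)
  case Nil
  then show ?case by (simp add: difference_closed.zero_mem [OF K])
next
  case (Cons c w)
  interpret K: difference_closed K by (fact K)
  let ?p = "path_sum (\<triangleright>) s"
  have eq: "(a \<triangleright> b) \<triangleright> c = (a \<triangleright> c) \<triangleright> (b \<triangleright> c)" using Cons.prems by (simp add: distrib)
  have "s a b + ?p (a \<triangleright> b) (c # w) - ?p a (c # w) - s (foldl (\<triangleright>) a (c # w)) (foldl (\<triangleright>) b (c # w))
    = (s (a \<triangleright> c) (b \<triangleright> c) + ?p ((a \<triangleright> c) \<triangleright> (b \<triangleright> c)) w - ?p (a \<triangleright> c) w
        - s (foldl (\<triangleright>) (a \<triangleright> c) w) (foldl (\<triangleright>) (b \<triangleright> c) w))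
      - (s a c + s (a \<triangleright> c) (b \<triangleright> c) - s a b - s (a \<triangleright> b) c)"
    by (simp add: eq algebra_simps)
  also have "\<dots> \<in> K"
    using Cons.prems by (intro K.diff_mem Cons.IH s) (simp_all add: qop_closed)
  finally show ?case .
qed

section \<open>Cocycles on Takasaki quandles\<close>

lemma carrier_takasaki [simp]: "carrier (takasaki G) = carrier G"
  by (simp add: takasaki_def)

context comm_group
begin

abbreviation tak (infixl \<open>\<bowtie>\<close> 70) where "a \<bowtie> b \<equiv> a \<triangleright>\<^bsub>takasaki G\<^esub> b"

lemma quandle_takasaki_group: "quandle (takasaki G)"
  by (intro quandle_takasaki comm_group_axioms)

lemma tak_closed [simp]: "a \<in> carrier G \<Longrightarrow> b \<in> carrier G \<Longrightarrow> a \<bowtie> b \<in> carrier G"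
  using quandle.qop_closed [OF quandle_takasaki_group] by simp

lemma mult_inv_mult_inv:
  "x \<in> carrier G \<Longrightarrow> c \<in> carrier G \<Longrightarrow> c \<otimes> inv (c \<otimes> inv x) = x"
  using m_comm [of x "inv c"] by (simp add: inv_mult_group m_assoc [symmetric])

lemma qop_takasaki:
  "b \<in> carrier G \<Longrightarrow> a \<bowtie> b = b \<otimes> b \<otimes> inv a"
  by (simp add: takasaki_def numeral_2_eq_2)

context
  fixes K :: "'x::ab_group_add set" and s :: "'a \<Rightarrow> 'a \<Rightarrow> 'x"
  assumes K: "difference_closed K"
    and diag: "\<And>a. a \<in> carrier G \<Longrightarrow> s a a \<in> K"
    and one_left: "\<And>a. a \<in> carrier G \<Longrightarrow> s \<one> a \<in> K"
    and cocycle: "\<And>a b c. \<lbrakk>a \<in> carrier G; b \<in> carrier G; c \<in> carrier G\<rbrakk>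
      \<Longrightarrow> s a c + s (a \<bowtie> c) (b \<bowtie> c)
        - s a b - s (a \<bowtie> b) c \<in> K"
    and div: "\<And>a. a \<in> carrier G \<Longrightarrow> \<exists>b\<in>carrier G. a = b \<otimes> b"
begin

interpretation K: difference_closed K by (fact K)
interpretation Q: quandle "takasaki G" by (rule quandle_takasaki_group)

text \<open>With \<open>a = b \<otimes> b = \<one> \<bowtie> b\<close>, the term
  \<open>s a \<one>\<close> is the only one in the cocycle identity at
  \<open>(\<one>, b, \<one>)\<close> whose first argument is not \<open>\<one>\<close>.\<close>

lemma takasaki_cocycle_one_right:
  assumes "a \<in> carrier G" shows "s a \<one> \<in> K"
proof -
  from div assms obtain b where b [simp]: "b \<in> carrier G" and a: "a = b \<otimes> b" by blast
  have c: "s \<one> \<one> + s \<one> (inv b) - s \<one> b - s a \<one> \<in> K"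
    using cocycle [of \<one> b \<one>] by (simp add: qop_takasaki a)
  have "s a \<one> = s \<one> \<one> + s \<one> (inv b) - s \<one> b - (s \<one> \<one> + s \<one> (inv b) - s \<one> b - s a \<one>)"
    by simp
  also have "\<dots> \<in> K" by (intro K.mem_intros c one_left) simp_all
  finally show ?thesis .
qed

text \<open>Acting by \<open>\<one>\<close> is inversion, so this is the cocycle identity at
  \<open>(a, b, \<one>)\<close> without the two vanishing terms.\<close>

lemma takasaki_cocycle_inv_inv:
  assumes [simp]: "a \<in> carrier G" "b \<in> carrier G" shows "s (inv a) (inv b) - s a b \<in> K"
proof -
  have c: "s a \<one> + s (inv a) (inv b) - s a b - s (a \<bowtie> b) \<one> \<in> K"
    using cocycle [of a b \<one>] by (simp add: qop_takasaki)
  have "s (inv a) (inv b) - s a b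
      = (s a \<one> + s (inv a) (inv b) - s a b - s (a \<bowtie> b) \<one>) - s a \<one> + s (a \<bowtie> b) \<one>" by simp
  also have "\<dots> \<in> K" by (intro K.mem_intros c takasaki_cocycle_one_right) simp_all
  finally show ?thesis .
qed

text \<open>A word acting trivially on the quandle commutes with every generator of the adjoint group,
  and the generators act transitively; hence the value of a cocycle along such a word does not
  depend on the base point.\<close>

lemma takasaki_path_sum_base_point:
  assumes w: "set w \<subseteq> carrier G" "\<And>x. x \<in> carrier G \<Longrightarrow> foldl (\<bowtie>) x w = x"
    and [simp]: "a \<in> carrier G" "a' \<in> carrier G"
  shows "path_sum (\<bowtie>) s a w - path_sum (\<bowtie>) s a' w \<in> K"
proof -
  from div obtain b where [simp]: "b \<in> carrier G" and b: "a \<otimes> a' = b \<otimes> b"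
    using m_closed [OF assms(3,4)] by blast
  have "a \<bowtie> b = a'" using b [symmetric] by (simp add: qop_takasaki m_comm [of a a'] m_assoc)
  \<comment> \<open>The word fixes \<open>b\<close> as well as the base points, so conjugating by
    \<open>b\<close> gives back the same \<open>s a b\<close>, which cancels.\<close>
  then have "s a b + path_sum (\<bowtie>) s a' w - path_sum (\<bowtie>) s a w - s a b \<in> K"
    using Q.path_sum_conjugate [OF K, of s a b w] cocycle w by simp
  then show ?thesis using K.uminus_mem by fastforce
qed

text \<open>The word \<open>[b, b]\<close> acts trivially, and from the base point \<open>b\<close>
  its path sum is twice \<open>s b b\<close>.\<close>

lemma takasaki_cocycle_reversal:
  assumes [simp]: "a \<in> carrier G" "b \<in> carrier G" shows "s a b + s (a \<bowtie> b) b \<in> K"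
proof -
  have "(x \<bowtie> b) \<bowtie> b = x" if "x \<in> carrier G" for x
    using that by (simp add: qop_takasaki mult_inv_mult_inv)
  then have p: "path_sum (\<bowtie>) s a [b, b] - path_sum (\<bowtie>) s b [b, b] \<in> K"
    by (intro takasaki_path_sum_base_point) simp_all
  have "b \<bowtie> b = b" using Q.idem by simp
  then have "s a b + s (a \<bowtie> b) b
      = (path_sum (\<bowtie>) s a [b, b] - path_sum (\<bowtie>) s b [b, b]) + s b b + s b b"
    by simp
  also have "\<dots> \<in> K" by (intro K.mem_intros p diag) simp_all
  finally show ?thesis .
qed

lemma takasaki_cocycle_fixed_base:
  assumes [simp]: "b \<in> carrier G" shows "s (\<one> \<bowtie> b) b \<in> K"
proof -
  have "s (\<one> \<bowtie> b) b = s \<one> b + s (\<one> \<bowtie> b) b - s \<one> b" by simp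
  also have "\<dots> \<in> K" by (intro K.diff_mem takasaki_cocycle_reversal one_left) simp_all
  finally show ?thesis .
qed

text \<open>Acting by \<open>c\<close> and then \<open>\<one>\<close> is translation by
  \<open>inv (c \<otimes> c)\<close>; followed by \<open>b\<close> it is the same as acting by
  \<open>b \<otimes> c\<close>. So the word \<open>?w\<close> acts trivially, and its path sums from
  \<open>a\<close> and from \<open>\<one>\<close> are compared. The result is the group 2-cocycle
  identity for \<open>h b c = s (inv (c \<otimes> c)) b\<close>.\<close>

lemma takasaki_cocycle_translation:
  assumes [simp]: "a \<in> carrier G" "b \<in> carrier G" "c \<in> carrier G"
  shows "s a c + s (a \<otimes> inv (c \<otimes> c)) b - s a (b \<otimes> c) - s (inv (c \<otimes> c)) b \<in> K"
proof -
  let ?w = "[c, \<one>, b, b \<otimes> c]"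
  have inv2: "(x \<bowtie> c) \<bowtie> \<one> = x \<otimes> inv (c \<otimes> c)" if "x \<in> carrier G" for x
    using that by (simp add: qop_takasaki inv_mult_group [of "c \<otimes> c" "inv x"])
  have step: "((x \<bowtie> c) \<bowtie> \<one>) \<bowtie> b = x \<bowtie> (b \<otimes> c)" if [simp]: "x \<in> carrier G" for x
  proof -
    have "((x \<bowtie> c) \<bowtie> \<one>) \<bowtie> b = b \<otimes> b \<otimes> (c \<otimes> c \<otimes> inv x)"
      unfolding inv2 [OF that] by (simp add: qop_takasaki inv_mult_group [of x "inv (c \<otimes> c)"])
    also have "\<dots> = x \<bowtie> (b \<otimes> c)" by (simp add: qop_takasaki m_ac)
    finally show ?thesis .
  qed
  have "(x \<bowtie> (b \<otimes> c)) \<bowtie> (b \<otimes> c) = x" if "x \<in> carrier G" for x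
    using that by (simp add: qop_takasaki mult_inv_mult_inv)
  then have p: "path_sum (\<bowtie>) s a ?w - path_sum (\<bowtie>) s \<one> ?w \<in> K"
    by (intro takasaki_path_sum_base_point) (simp_all add: step)
  have [simp]: "\<one> \<bowtie> c \<bowtie> \<one> = inv (c \<otimes> c)" using inv2 [of \<one>] by simp
  have [simp]: "inv (c \<otimes> c) \<bowtie> b = \<one> \<bowtie> (b \<otimes> c)" using step [of \<one>] by simp
  have [simp]: "(a \<otimes> inv (c \<otimes> c)) \<bowtie> b = a \<bowtie> (b \<otimes> c)" using step [of a] inv2 [of a] by simp
  \<comment> \<open>The letter \<open>b\<close> contributes the two terms with second argument
    \<open>b\<close>. The last letter contributes \<open>- s a (b \<otimes> c)\<close> from the base
    point \<open>a\<close>, by reversal, and nothing from \<open>\<one>\<close>. The letter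
    \<open>\<one>\<close> contributes nothing at all.\<close>
  have "s a c + s (a \<otimes> inv (c \<otimes> c)) b - s a (b \<otimes> c) - s (inv (c \<otimes> c)) b =
    (path_sum (\<bowtie>) s a ?w - path_sum (\<bowtie>) s \<one> ?w)
    - s (a \<bowtie> c) \<one> + s \<one> c + s (\<one> \<bowtie> c) \<one> + s (\<one> \<bowtie> (b \<otimes> c)) (b \<otimes> c)
    - (s a (b \<otimes> c) + s (a \<bowtie> (b \<otimes> c)) (b \<otimes> c))"
    by (simp add: inv2)
  also have "\<dots> \<in> K"
    by (intro K.add_mem [of "_ + _ + _"] K.add_mem [of "_ + s \<one> c"] K.add_mem [of _ "s \<one> c"] K.diff_mem
        p takasaki_cocycle_reversal one_left takasaki_cocycle_one_right takasaki_cocycle_fixed_base) simp_all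
  finally show ?thesis .
qed

text \<open>In the cocycle identity at \<open>(inv (c \<otimes> c), \<one>, c)\<close> every other
  term has the form \<open>s (\<one> \<bowtie> x) x\<close> or \<open>s x \<one>\<close>, and both
  kinds vanish. This is the diagonal condition for \<open>h\<close>.\<close>

lemma takasaki_cocycle_diagonal:
  assumes [simp]: "c \<in> carrier G" shows "s (inv (c \<otimes> c)) c \<in> K"
proof -
  let ?a = "inv (c \<otimes> c)"
  have sq: "\<one> \<bowtie> x = x \<otimes> x" "inv (x \<otimes> x) \<bowtie> \<one> = \<one> \<bowtie> x" "inv (x \<otimes> x) \<bowtie> x = \<one> \<bowtie> (x \<otimes> x)"
    if "x \<in> carrier G" for x using that by (simp_all add: qop_takasaki)
  have c: "s ?a c + s (\<one> \<bowtie> (c \<otimes> c)) (c \<otimes> c) - s ?a \<one> - s (\<one> \<bowtie> c) c \<in> K"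
    using cocycle [of ?a \<one> c] by (simp add: sq(2,3)) (simp add: sq(1))
  have "s ?a c = (s ?a c + s (\<one> \<bowtie> (c \<otimes> c)) (c \<otimes> c) - s ?a \<one> - s (\<one> \<bowtie> c) c)
      - s (\<one> \<bowtie> (c \<otimes> c)) (c \<otimes> c) + s ?a \<one> + s (\<one> \<bowtie> c) c"
    by simp
  also have "\<dots> \<in> K"
    by (intro K.add_mem K.diff_mem [of _ "s (\<one> \<bowtie> (c \<otimes> c)) (c \<otimes> c)"] c takasaki_cocycle_one_right takasaki_cocycle_fixed_base) simp_all
  finally show ?thesis .
qed

text \<open>The function \<open>h\<close> satisfies all the hypotheses on alternating cocycles,
  hence is bilinear. Every element has the form \<open>inv (d \<otimes> d)\<close>, so statements
  about \<open>h\<close> cover all values of \<open>s\<close>.\<close>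

lemma
  assumes abc: "a \<in> carrier G" "b \<in> carrier G" "c \<in> carrier G"
  shows takasaki_cocycle_bilinear_right: "s a (b \<otimes> c) - s a b - s a c \<in> K"
    and takasaki_cocycle_bilinear_left: "s (a \<otimes> b) c - s a c - s b c \<in> K"
proof -
  define h where "h b c = s (inv (c \<otimes> c)) b" for b c
  have coc: "h x y + h (x \<otimes> y) z - h y z - h x (y \<otimes> z) \<in> K"
    if [simp]: "x \<in> carrier G" "y \<in> carrier G" "z \<in> carrier G" for x y z
  proof -
    have "inv (z \<otimes> z) \<otimes> inv (y \<otimes> y) = inv (y \<otimes> z \<otimes> (y \<otimes> z))"
      by (simp add: inv_mult m_ac)
    then have "h x y + h (x \<otimes> y) z - h y z - h x (y \<otimes> z) = - (s (inv (z \<otimes> z)) y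
        + s (inv (z \<otimes> z) \<otimes> inv (y \<otimes> y)) x - s (inv (z \<otimes> z)) (x \<otimes> y) - s (inv (y \<otimes> y)) x)"
      by (simp add: h_def)
    also have "\<dots> \<in> K" by (intro K.uminus_mem takasaki_cocycle_translation) simp_all
    finally show ?thesis .
  qed
  have diag: "h x x \<in> K" if "x \<in> carrier G" for x
    using takasaki_cocycle_diagonal [OF that] by (simp add: h_def)
  have anti: "h x (inv x) \<in> K" if "x \<in> carrier G" for x
    using takasaki_cocycle_fixed_base [OF that] that by (simp add: h_def qop_takasaki inv_mult_group)
  have one: "h x \<one> \<in> K" if "x \<in> carrier G" for x
    using one_left [OF that] by (simp add: h_def)
  have even: "h (inv x) (inv y) - h x y \<in> K" if "x \<in> carrier G" "y \<in> carrier G" for x y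
    using takasaki_cocycle_inv_inv [of "inv (y \<otimes> y)" x] that by (simp add: h_def inv_mult)
  note bil = alternating_cocycle_bilinear [where h = h, OF K coc diag anti one even div]
  note asym = alternating_cocycle_antisym [where h = h, OF K coc diag anti one even]
  have root: "\<exists>y\<in>carrier G. x = inv (y \<otimes> y)" if "x \<in> carrier G" for x
    using div [of "inv x"] that by (metis inv_closed inv_inv)
  obtain d where "d \<in> carrier G" "a = inv (d \<otimes> d)" using root abc by blast
  with bil [of b c d] abc show "s a (b \<otimes> c) - s a b - s a c \<in> K" by (simp add: h_def)
  obtain u v where uv [simp]: "u \<in> carrier G" "v \<in> carrier G"
    and eq: "a = inv (u \<otimes> u)" "b = inv (v \<otimes> v)" using root abc by metis
  have ab: "a \<otimes> b = inv (u \<otimes> v \<otimes> (u \<otimes> v))" unfolding eq by (simp add: inv_mult m_ac)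
  \<comment> \<open>The first argument of \<open>s\<close> is the second argument of
    \<open>h\<close>, where additivity follows from the first by antisymmetry.\<close>
  have "s (a \<otimes> b) c - s a c - s b c = h c (u \<otimes> v) - h c u - h c v"
    unfolding ab unfolding eq h_def ..
  also have "\<dots> = h c (u \<otimes> v) + h (u \<otimes> v) c - (h c u + h u c) - (h c v + h v c)
      - (h (u \<otimes> v) c - h u c - h v c)"
    by simp
  also have "\<dots> \<in> K"
    by (intro K.diff_mem [OF K.diff_mem [OF K.diff_mem]] asym bil) (simp_all add: abc)
  finally show "s (a \<otimes> b) c - s a c - s b c \<in> K" .
qed

end

end

section \<open>The exterior square as a quotient of a free abelian group\<close>

text \<open>The two nested quotients are combined into one projection from the free abelian group on
  pairs, so that its kernel holds all relations of the exterior square at once.\<close>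

definition wedge_proj :: "('a, 'b) monoid_scheme \<Rightarrow> ('a \<times> 'a \<Rightarrow>\<^sub>0 int) \<Rightarrow> ('a \<times> 'a \<Rightarrow>\<^sub>0 int) set set"
  where "wedge_proj G z = generate (tensor_product G G) {pure_tensor G G x x | x. x \<in> carrier G}
    #>\<^bsub>tensor_product G G\<^esub> (tensor_relations G G #>\<^bsub>free_Abelian_group (carrier G \<times> carrier G)\<^esub> z)"

context comm_group
begin

abbreviation pair_group where "pair_group \<equiv> free_Abelian_group (carrier G \<times> carrier G)"

abbreviation wedge_kernel where "wedge_kernel \<equiv> kernel pair_group (exterior_square G) (wedge_proj G)"

lemma bilinear_relations_carrier: "bilinear_relations G G \<subseteq> carrier pair_group"
  unfolding bilinear_relations_def by (auto dest!: keys_diff [THEN subsetD])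

lemma tensor_relations_normal: "tensor_relations G G \<lhd> pair_group"
  unfolding tensor_relations_def
  by (intro comm_group.normal_generate abelian_free_Abelian_group bilinear_relations_carrier)

lemma comm_group_tensor_square: "comm_group (tensor_product G G)"
  by (intro comm_group_tensor_product comm_group_axioms)

lemma pure_tensor_squares_carrier:
  "{pure_tensor G G x x | x. x \<in> carrier G} \<subseteq> carrier (tensor_product G G)"
  by (auto simp: pure_tensor_def tensor_product_def carrier_FactGroup)

lemma tensor_squares_normal:
  "generate (tensor_product G G) {pure_tensor G G x x | x. x \<in> carrier G} \<lhd> tensor_product G G"
  by (intro comm_group.normal_generate comm_group_tensor_square pure_tensor_squares_carrier)

lemma group_exterior_square: "group (exterior_square G)"
  by (intro comm_group.axioms comm_group_exterior_square comm_group_axioms)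

lemma wedge_proj_hom: "wedge_proj G \<in> hom pair_group (exterior_square G)"
  using Group.hom_compose [OF normal.r_coset_hom_Mod [OF tensor_relations_normal]
      normal.r_coset_hom_Mod [OF tensor_squares_normal, unfolded tensor_product_def]]
  by (simp add: wedge_proj_def [abs_def] exterior_square_def tensor_product_def o_def)

lemma wedge_proj_surj: "wedge_proj G ` carrier pair_group = carrier (exterior_square G)"
  by (simp add: wedge_proj_def [abs_def] exterior_square_def tensor_product_def carrier_FactGroup image_image)

lemma difference_closed_wedge_kernel: "difference_closed wedge_kernel"
  by (intro difference_closed_kernel wedge_proj_hom group_exterior_square)

lemma tensor_relations_wedge_kernel:
  assumes "z \<in> tensor_relations G G" shows "z \<in> wedge_kernel"
proof -
  interpret R: normal "tensor_relations G G" pair_group by (rule tensor_relations_normal)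
  interpret A: normal "generate (tensor_product G G) {pure_tensor G G x x | x. x \<in> carrier G}"
    "tensor_product G G" by (rule tensor_squares_normal)
  have z: "z \<in> carrier pair_group" using assms by (rule R.mem_carrier)
  have "tensor_relations G G #>\<^bsub>pair_group\<^esub> z = \<one>\<^bsub>tensor_product G G\<^esub>"
    using R.rcos_const [OF R.is_group assms] by (simp add: tensor_product_def)
  then have "wedge_proj G z = \<one>\<^bsub>exterior_square G\<^esub>"
    using A.rcos_const [OF A.is_group subgroup.one_closed [OF A.subgroup_axioms]] by (simp add: wedge_proj_def exterior_square_def)
  with z show ?thesis by (simp add: kernel_def)
qed

lemma wedge_kernel_bilinear:
  assumes "x \<in> carrier G" "y \<in> carrier G" "z \<in> carrier G"
  shows "frag_of (x \<otimes> y, z) - frag_of (x, z) - frag_of (y, z) \<in> wedge_kernel"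
    and "frag_of (x, y \<otimes> z) - frag_of (x, y) - frag_of (x, z) \<in> wedge_kernel"
  by (rule tensor_relations_wedge_kernel, unfold tensor_relations_def, rule generate.incl,
      use assms in \<open>unfold bilinear_relations_def, blast\<close>)+

lemma wedge_kernel_diagonal:
  assumes "x \<in> carrier G" shows "frag_of (x, x) \<in> wedge_kernel"
proof -
  interpret A: normal "generate (tensor_product G G) {pure_tensor G G x x | x. x \<in> carrier G}"
    "tensor_product G G" by (rule tensor_squares_normal)
  have "pure_tensor G G x x \<in> generate (tensor_product G G) {pure_tensor G G x x | x. x \<in> carrier G}"
    using assms by (blast intro: generate.incl)
  then have "wedge_proj G (frag_of (x, x)) = \<one>\<^bsub>exterior_square G\<^esub>"
    using A.rcos_const [OF A.is_group] by (simp add: wedge_proj_def exterior_square_def pure_tensor_def)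
  with assms show ?thesis by (simp add: kernel_def)
qed

text \<open>This is the universal property of the exterior square, read on the free group: a linear
  map that is bilinear and alternating modulo \<open>K\<close> on generators sends the whole kernel
  into \<open>K\<close>.\<close>

lemma wedge_kernel_universal:
  fixes t :: "'a \<times> 'a \<Rightarrow> 'c \<Rightarrow>\<^sub>0 int"
  assumes K: "difference_closed K"
    and left: "\<And>x y z. \<lbrakk>x \<in> carrier G; y \<in> carrier G; z \<in> carrier G\<rbrakk>
      \<Longrightarrow> t (x \<otimes> y, z) - t (x, z) - t (y, z) \<in> K"
    and right: "\<And>x y z. \<lbrakk>x \<in> carrier G; y \<in> carrier G; z \<in> carrier G\<rbrakk>
      \<Longrightarrow> t (x, y \<otimes> z) - t (x, y) - t (x, z) \<in> K"
    and diag: "\<And>x. x \<in> carrier G \<Longrightarrow> t (x, x) \<in> K"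
    and z: "z \<in> wedge_kernel"
  shows "frag_extend t z \<in> K"
proof -
  interpret K: difference_closed K by fact
  interpret R: normal "tensor_relations G G" pair_group by (rule tensor_relations_normal)
  let ?T = "tensor_product G G" and ?P = "{pure_tensor G G x x | x. x \<in> carrier G}"
  interpret A: normal "generate ?T ?P" ?T by (rule tensor_squares_normal)
  have rel: "frag_extend t r \<in> K" if "r \<in> tensor_relations G G" for r
  proof -
    have "frag_extend t ` bilinear_relations G G \<subseteq> K"
      by (auto simp: bilinear_relations_def frag_extend_diff left right)
    then have "frag_extend t ` tensor_relations G G \<subseteq> K"
      unfolding tensor_relations_def
      by (intro hom_generate_subset [OF frag_extend_hom] bilinear_relations_carrier
          subgroup_difference_closed K) simp_all
    with that show ?thesis by blast
  qed
  \<comment> \<open>Elements of the generated subgroup are cosets. The induction claims membership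
    in \<open>K\<close> for every representative, a property that passes to products of
    cosets.\<close>
  have gen: "\<forall>c\<in>C. frag_extend t c \<in> K" if "C \<in> generate ?T ?P" for C
    using that
  proof induction
    case one
    then show ?case using rel by (simp add: tensor_product_def)
  next
    case (incl C)
    then obtain x where "x \<in> carrier G" "C = pure_tensor G G x x" by blast
    then show ?case
      by (simp add: pure_tensor_def r_coset_def frag_extend_add K.add_mem rel diag)
  next
    case (inv C)
    then obtain x where x: "x \<in> carrier G" "C = pure_tensor G G x x" by blast
    then have "inv\<^bsub>?T\<^esub> C = tensor_relations G G #>\<^bsub>pair_group\<^esub> (- frag_of (x, x))"
      using R.rcos_inv [of "frag_of (x, x)"] R.inv_FactGroup [of C]
      by (auto simp: tensor_product_def pure_tensor_def carrier_FactGroup)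
    with x show ?case
      by (simp add: r_coset_def frag_extend_diff K.diff_mem rel diag)
  next
    case (eng C D)
    then show ?case
      by (simp add: tensor_product_def set_mult_def frag_extend_add K.add_mem)
  qed
  have zF: "z \<in> carrier pair_group" using z by (simp add: kernel_def)
  have zT: "tensor_relations G G #>\<^bsub>pair_group\<^esub> z \<in> carrier ?T"
    using zF by (auto simp: tensor_product_def carrier_FactGroup)
  have "generate ?T ?P #>\<^bsub>?T\<^esub> (tensor_relations G G #>\<^bsub>pair_group\<^esub> z) = generate ?T ?P"
    using z by (simp add: kernel_def wedge_proj_def exterior_square_def)
  then have "tensor_relations G G #>\<^bsub>pair_group\<^esub> z \<in> generate ?T ?P"
    using A.coset_join1 zT A.subgroup_axioms A.subset by blast
  with gen R.rcos_self [OF zF R.subgroup_axioms] show ?thesis by blast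
qed

end

section \<open>Isomorphic quotients\<close>

text \<open>Both groups are the quotient of \<open>Z\<close> by the common kernel. Comparing kernels
  avoids defining a map on cosets of cosets.\<close>

lemma iso_of_same_kernel:
  assumes f: "f \<in> hom Z H" "f ` carrier Z = carrier H"
    and g: "g \<in> hom Z E" "g ` carrier Z = carrier E"
    and grp: "group Z" "group H" "group E"
    and eq: "kernel Z H f = kernel Z E g"
  shows "H \<cong> E"
proof -
  interpret f: group_hom Z H f using f grp by (simp add: group_hom_def group_hom_axioms_def)
  interpret g: group_hom Z E g using g grp by (simp add: group_hom_def group_hom_axioms_def)
  have "group (Z Mod kernel Z H f)" using f.normal_kernel by (rule normal.factorgroup_is_group)
  moreover have "Z Mod kernel Z H f \<cong> H" using f(2) by (rule f.FactGroup_iso)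
  ultimately have "H \<cong> Z Mod kernel Z H f" by (simp add: group.iso_sym)
  moreover have "Z Mod kernel Z H f \<cong> E" unfolding eq using g(2) by (rule g.FactGroup_iso)
  ultimately show ?thesis by (rule iso_trans)
qed

section \<open>Presentation of the second quandle homology group\<close>

context quandle
begin

text \<open>There are no nonzero degenerate 1-chains, so a 2-chain represents a quandle cycle
  exactly if its rack boundary is 0, not merely degenerate.\<close>

definition rack_cycles :: "('a list \<Rightarrow>\<^sub>0 int) set"
  where "rack_cycles = {c \<in> carrier (rack_chain_group Q 2). rack_boundary Q c = 0}"

definition null_chains :: "('a list \<Rightarrow>\<^sub>0 int) set"
  where "null_chains = {d + rack_boundary Q y | d y.
    d \<in> degenerate_chains Q 2 \<and> y \<in> carrier (rack_chain_group Q 3)}"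

abbreviation cycle_monoid where "cycle_monoid \<equiv> rack_chain_group Q 2 \<lparr>carrier := rack_cycles\<rparr>"

lemma degenerate_chains_1: "degenerate_chains Q 1 = {0}"
proof -
  have "degenerate_chains Q 1 = generate (rack_chain_group Q 1) {}"
    by (simp add: degenerate_chains_def)
  also have "\<dots> = {0}"
    using group.generate_empty [OF comm_group.axioms(2) [OF comm_group_rack_chain_group]]
    by (simp add: rack_chain_group_def)
  finally show ?thesis .
qed

lemma rack_boundary_simps:
  "rack_boundary Q 0 = 0"
  "rack_boundary Q (x + y) = rack_boundary Q x + rack_boundary Q y"
  "rack_boundary Q (x - y) = rack_boundary Q x - rack_boundary Q y"
  "rack_boundary Q (- x) = - rack_boundary Q x"
  by (simp_all add: rack_boundary_def frag_extend_add frag_extend_diff frag_extend_minus)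

lemma rack_boundary_degenerate_2: "d \<in> degenerate_chains Q 2 \<Longrightarrow> rack_boundary Q d = 0"
  using rack_boundary_degenerate [of 2] degenerate_chains_1 by auto

lemma subgroup_degenerate: "subgroup (degenerate_chains Q n) (rack_chain_group Q n)"
  by (rule normal_imp_subgroup [OF degenerate_chains_normal])

lemma difference_closed_degenerate: "difference_closed (degenerate_chains Q n)"
  using difference_closed_subgroup subgroup_degenerate unfolding rack_chain_group_def by blast

lemma difference_closed_rack_chains: "difference_closed (carrier (rack_chain_group Q n))"
  unfolding rack_chain_group_def by (rule difference_closed_subgroup [OF group.subgroup_self]) simp

lemma difference_closed_null_chains: "difference_closed null_chains"
proof -
  interpret C: difference_closed "carrier (rack_chain_group Q 3)" by (rule difference_closed_rack_chains)
  interpret D: difference_closed "degenerate_chains Q 2" by (rule difference_closed_degenerate)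
  show ?thesis
  proof
    have "0 \<in> carrier (rack_chain_group Q 3)" by (simp add: carrier_rack_chain_group)
    then show "0 \<in> null_chains" unfolding null_chains_def using D.zero_mem rack_boundary_simps(1) by force
  next
    fix x y assume "x \<in> null_chains" "y \<in> null_chains"
    then obtain d e u v where "x = d + rack_boundary Q u" "y = e + rack_boundary Q v"
      "d \<in> degenerate_chains Q 2" "e \<in> degenerate_chains Q 2"
      "u \<in> carrier (rack_chain_group Q 3)" "v \<in> carrier (rack_chain_group Q 3)"
      by (auto simp: null_chains_def)
    then have "x - y = (d - e) + rack_boundary Q (u - v)" "d - e \<in> degenerate_chains Q 2"
      "u - v \<in> carrier (rack_chain_group Q 3)"
      by (simp_all add: rack_boundary_simps D.diff_mem C.diff_mem)
    then show "x - y \<in> null_chains" unfolding null_chains_def by blast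
  qed
qed

lemma degenerate_null: "d \<in> degenerate_chains Q 2 \<Longrightarrow> d \<in> null_chains"
  unfolding null_chains_def
  by (rule CollectI, rule exI [of _ d], rule exI [of _ 0])
    (simp add: rack_boundary_simps carrier_rack_chain_group)

lemma boundary_null: "y \<in> carrier (rack_chain_group Q 3) \<Longrightarrow> rack_boundary Q y \<in> null_chains"
  unfolding null_chains_def
  using difference_closed.zero_mem [OF difference_closed_degenerate, of 2] by force

lemma diagonal_degenerate:
  assumes "a \<in> carrier Q" shows "frag_of [a, a] \<in> degenerate_chains Q 2"
  unfolding degenerate_chains_def
  by (rule generate.incl) (use assms in \<open>auto simp: tuples_def intro!: exI [of _ "[a, a]"]\<close>)

lemma degenerate_chains_2:
  "degenerate_chains Q 2 = generate (rack_chain_group Q 2) {frag_of [a, a] | a. a \<in> carrier Q}"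
proof -
  have "{frag_of xs | xs. xs \<in> tuples Q 2 \<and> (\<exists>i. Suc i < 2 \<and> xs ! i = xs ! Suc i)}
      = {frag_of [a, a] | a. a \<in> carrier Q}"
  proof (intro Set.set_eqI iffI)
    fix x :: "'a list \<Rightarrow>\<^sub>0 int"
    assume "x \<in> {frag_of xs | xs. xs \<in> tuples Q 2 \<and> (\<exists>i. Suc i < 2 \<and> xs ! i = xs ! Suc i)}"
    then show "x \<in> {frag_of [a, a] | a. a \<in> carrier Q}"
      by (auto simp: tuples_def length_Suc_conv numeral_2_eq_2)
  next
    fix x :: "'a list \<Rightarrow>\<^sub>0 int" assume "x \<in> {frag_of [a, a] | a. a \<in> carrier Q}"
    then obtain a where "a \<in> carrier Q" "x = frag_of [a, a]" by blast
    then show "x \<in> {frag_of xs | xs. xs \<in> tuples Q 2 \<and> (\<exists>i. Suc i < 2 \<and> xs ! i = xs ! Suc i)}"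
      by (auto simp: tuples_def intro!: exI [of _ "[a, a]"])
  qed
  then show ?thesis by (simp add: degenerate_chains_def)
qed

lemma subgroup_rack_cycles: "subgroup rack_cycles (rack_chain_group Q 2)"
proof -
  interpret h: group_hom "rack_chain_group Q 2" "rack_chain_group Q 1" "rack_boundary Q"
  proof -
    interpret C: comm_group "rack_chain_group Q n" for n by (rule comm_group_rack_chain_group)
    show "group_hom (rack_chain_group Q 2) (rack_chain_group Q 1) (rack_boundary Q)"
      using rack_boundary_hom [of 2] by unfold_locales simp
  qed
  have "rack_cycles = kernel (rack_chain_group Q 2) (rack_chain_group Q 1) (rack_boundary Q)"
    by (simp add: rack_cycles_def kernel_def) (simp add: rack_chain_group_def)
  then show ?thesis using h.subgroup_kernel by simp
qed

lemma group_cycle_monoid: "group cycle_monoid"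
  by (intro subgroup.subgroup_is_group subgroup_rack_cycles comm_group.axioms(2) comm_group_rack_chain_group)

lemma degenerate_coset_eq_iff:
  assumes "x \<in> carrier (rack_chain_group Q n)" "y \<in> carrier (rack_chain_group Q n)"
  shows "degenerate_chains Q n #>\<^bsub>rack_chain_group Q n\<^esub> x = degenerate_chains Q n #>\<^bsub>rack_chain_group Q n\<^esub> y
    \<longleftrightarrow> x - y \<in> degenerate_chains Q n"
proof -
  interpret C: comm_group "rack_chain_group Q n" by (rule comm_group_rack_chain_group)
  interpret D: difference_closed "degenerate_chains Q n" by (rule difference_closed_degenerate)
  show ?thesis
  proof
    assume "degenerate_chains Q n #>\<^bsub>rack_chain_group Q n\<^esub> x = degenerate_chains Q n #>\<^bsub>rack_chain_group Q n\<^esub> y"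
    with C.rcos_self [OF assms(1) subgroup_degenerate]
    have "x \<in> degenerate_chains Q n #>\<^bsub>rack_chain_group Q n\<^esub> y" by simp
    then show "x - y \<in> degenerate_chains Q n" by (auto simp: r_coset_def rack_chain_group_def)
  next
    assume *: "x - y \<in> degenerate_chains Q n"
    have "x \<in> degenerate_chains Q n #>\<^bsub>rack_chain_group Q n\<^esub> y"
      using * by (auto simp: r_coset_def rack_chain_group_def intro!: bexI [of _ "x - y"])
    then show "degenerate_chains Q n #>\<^bsub>rack_chain_group Q n\<^esub> x = degenerate_chains Q n #>\<^bsub>rack_chain_group Q n\<^esub> y"
      using C.repr_independence [OF _ assms(2) subgroup_degenerate] by simp
  qed
qed

definition homology_class :: "('a list \<Rightarrow>\<^sub>0 int) \<Rightarrow> ('a list \<Rightarrow>\<^sub>0 int) set set"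
  where "homology_class c = quandle_boundary Q 3 ` carrier (quandle_chain_group Q 3)
    #>\<^bsub>quandle_cycle_group Q 2\<^esub> (degenerate_chains Q 2 #>\<^bsub>rack_chain_group Q 2\<^esub> c)"

text \<open>Presents the second homology group as \<open>rack_cycles\<close> modulo
  \<open>null_chains\<close>; the remaining argument is about chains and not about cosets.\<close>

lemma homology_class_presentation:
  shows homology_class_hom: "homology_class \<in> hom cycle_monoid (quandle_homology 2 Q)"
    and homology_class_surj: "homology_class ` carrier cycle_monoid = carrier (quandle_homology 2 Q)"
    and homology_class_kernel: "kernel cycle_monoid (quandle_homology 2 Q) homology_class = null_chains"
proof -
  let ?C = "rack_chain_group Q 2" and ?D = "degenerate_chains Q 2"
  let ?C2 = "quandle_chain_group Q 2" and ?C3 = "quandle_chain_group Q 3"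
  let ?Z = "quandle_cycle_group Q 2"
  let ?B = "quandle_boundary Q 3 ` carrier ?C3"
  let ?k = "kernel ?C2 (quandle_chain_group Q 1) (quandle_boundary Q 2)"
  interpret C: comm_group ?C by (rule comm_group_rack_chain_group)
  interpret D: normal ?D ?C by (rule degenerate_chains_normal)
  interpret C1: comm_group "quandle_chain_group Q 1" by (rule comm_group_quandle_chain_group)
  interpret C2: comm_group ?C2 by (rule comm_group_quandle_chain_group)
  interpret C3: comm_group ?C3 by (rule comm_group_quandle_chain_group)
  interpret h2: group_hom ?C2 "quandle_chain_group Q 1" "quandle_boundary Q 2"
    using quandle_boundary_hom [of 2] by unfold_locales simp
  interpret h3: group_hom ?C3 ?C2 "quandle_boundary Q 3"
    using quandle_boundary_hom [of 3] by unfold_locales simp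
  have closed: "rack_boundary Q c \<in> carrier (rack_chain_group Q 1)" if "c \<in> carrier ?C" for c
    using hom_in_carrier [OF rack_boundary_hom [of 2]] that by simp
  have closed3: "rack_boundary Q y \<in> carrier ?C" if "y \<in> carrier (rack_chain_group Q 3)" for y
    using hom_in_carrier [OF rack_boundary_hom [of 3]] that by simp
  have one1: "\<one>\<^bsub>quandle_chain_group Q 1\<^esub> = degenerate_chains Q 1 #>\<^bsub>rack_chain_group Q 1\<^esub> 0"
    by (simp add: quandle_chain_group_def r_coset_def) (simp add: rack_chain_group_def)
  have "quandle_boundary Q 2 (?D #>\<^bsub>?C\<^esub> c) = \<one>\<^bsub>quandle_chain_group Q 1\<^esub> \<longleftrightarrow> rack_boundary Q c = 0"
    if "c \<in> carrier ?C" for c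
  proof -
    have "quandle_boundary Q 2 (?D #>\<^bsub>?C\<^esub> c) = degenerate_chains Q 1 #>\<^bsub>rack_chain_group Q 1\<^esub> rack_boundary Q c"
      using quandle_boundary_coset [of 2 c] that by simp
    moreover have "0 \<in> carrier (rack_chain_group Q 1)" by (simp add: carrier_rack_chain_group)
    ultimately show ?thesis
      unfolding one1 using degenerate_coset_eq_iff [OF closed [OF that], of 0] degenerate_chains_1 by simp
  qed
  then have k: "?k = (\<lambda>c. ?D #>\<^bsub>?C\<^esub> c) ` rack_cycles"
    by (auto simp: kernel_def rack_cycles_def quandle_chain_group_def carrier_FactGroup)
  have carrZ: "carrier ?Z = (\<lambda>c. ?D #>\<^bsub>?C\<^esub> c) ` rack_cycles"
    unfolding quandle_cycle_group_def
    using subgroup.carrier_subgroup_generated_subgroup [OF h2.subgroup_kernel] k by simp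
  have B: "?B = (\<lambda>y. ?D #>\<^bsub>?C\<^esub> rack_boundary Q y) ` carrier (rack_chain_group Q 3)"
  proof -
    have "carrier ?C3 = (\<lambda>y. degenerate_chains Q 3 #>\<^bsub>rack_chain_group Q 3\<^esub> y) ` carrier (rack_chain_group Q 3)"
      by (simp add: quandle_chain_group_def carrier_FactGroup)
    moreover have "quandle_boundary Q 3 (degenerate_chains Q 3 #>\<^bsub>rack_chain_group Q 3\<^esub> y)
        = ?D #>\<^bsub>?C\<^esub> rack_boundary Q y" if "y \<in> carrier (rack_chain_group Q 3)" for y
      using quandle_boundary_coset [of 3 y] that by simp
    ultimately show ?thesis by (simp add: image_image cong: image_cong)
  qed
  have "?B \<subseteq> ?k"
    unfolding B k using rack_boundary_rack_boundary closed3 by (auto simp: rack_cycles_def)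
  then have subB: "subgroup ?B ?Z"
    using C2.subgroup_of_subgroup_generated [of ?B ?k] h3.img_is_subgroup by (simp add: quandle_cycle_group_def)
  have commZ: "comm_group ?Z"
    using C2.abelian_subgroup_generated [OF C2.comm_group_axioms] by (simp add: quandle_cycle_group_def)
  interpret Z: comm_group ?Z by (rule commZ)
  interpret B: normal ?B ?Z using subB by (simp add: Z.normal_iff_subgroup)
  have "(\<lambda>c. ?D #>\<^bsub>?C\<^esub> c) \<in> hom cycle_monoid ?Z"
  proof (rule homI)
    fix x y assume "x \<in> carrier cycle_monoid" "y \<in> carrier cycle_monoid"
    then show "?D #>\<^bsub>?C\<^esub> (x \<otimes>\<^bsub>cycle_monoid\<^esub> y) = (?D #>\<^bsub>?C\<^esub> x) \<otimes>\<^bsub>?Z\<^esub> (?D #>\<^bsub>?C\<^esub> y)"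
      by (simp add: quandle_cycle_group_def quandle_chain_group_def rack_cycles_def D.rcos_sum)
  qed (simp add: carrZ)
  from Group.hom_compose [OF this B.r_coset_hom_Mod]
  show "homology_class \<in> hom cycle_monoid (quandle_homology 2 Q)"
    by (simp add: homology_class_def [abs_def] quandle_homology_def o_def)
  show "homology_class ` carrier cycle_monoid = carrier (quandle_homology 2 Q)"
    by (simp add: homology_class_def [abs_def] quandle_homology_def carrier_FactGroup carrZ image_image)
  have one: "\<one>\<^bsub>quandle_homology 2 Q\<^esub> = ?B" by (simp add: quandle_homology_def)
  have "homology_class c = ?B \<longleftrightarrow> c \<in> null_chains" if c: "c \<in> rack_cycles" for c
  proof -
    have cC: "c \<in> carrier ?C" using c by (simp add: rack_cycles_def)
    have DZ: "?D #>\<^bsub>?C\<^esub> c \<in> carrier ?Z" using c carrZ by blast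
    have "homology_class c = ?B \<longleftrightarrow> ?D #>\<^bsub>?C\<^esub> c \<in> ?B"
      unfolding homology_class_def
      using Z.coset_join1 [OF _ DZ subB] Z.coset_join2 [OF DZ subB] by blast
    also have "\<dots> \<longleftrightarrow> (\<exists>y\<in>carrier (rack_chain_group Q 3). c - rack_boundary Q y \<in> ?D)"
      unfolding B using degenerate_coset_eq_iff [OF cC closed3] by auto
    also have "\<dots> \<longleftrightarrow> c \<in> null_chains"
    proof
      assume "\<exists>y\<in>carrier (rack_chain_group Q 3). c - rack_boundary Q y \<in> ?D"
      then obtain y where y: "y \<in> carrier (rack_chain_group Q 3)" "c - rack_boundary Q y \<in> ?D" ..
      moreover have "c = (c - rack_boundary Q y) + rack_boundary Q y" by simp
      ultimately show "c \<in> null_chains" unfolding null_chains_def by blast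
    next
      assume "c \<in> null_chains"
      then obtain d y where "c = d + rack_boundary Q y" "d \<in> ?D" "y \<in> carrier (rack_chain_group Q 3)"
        unfolding null_chains_def by blast
      then show "\<exists>y\<in>carrier (rack_chain_group Q 3). c - rack_boundary Q y \<in> ?D"
        by (intro bexI [of _ y]) simp_all
    qed
    finally show ?thesis .
  qed
  \<comment> \<open>The kernel is formed inside the cycles, so it is all of
    \<open>null_chains\<close> only because null chains are cycles.\<close>
  moreover have "null_chains \<subseteq> rack_cycles"
  proof
    fix c assume "c \<in> null_chains"
    then obtain d y where c: "c = d + rack_boundary Q y" "d \<in> ?D" "y \<in> carrier (rack_chain_group Q 3)"
      unfolding null_chains_def by blast
    have "d \<otimes>\<^bsub>?C\<^esub> rack_boundary Q y \<in> carrier ?C" using c closed3 D.mem_carrier by blast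
    then have "c \<in> carrier ?C" using c by (simp add: rack_chain_group_def)
    then show "c \<in> rack_cycles"
      using c by (simp add: rack_cycles_def rack_boundary_simps rack_boundary_degenerate_2 rack_boundary_rack_boundary)
  qed
  ultimately show "kernel cycle_monoid (quandle_homology 2 Q) homology_class = null_chains"
    unfolding kernel_def one by (simp add: set_eq_iff) blast
qed

end

section \<open>Bilinear maps are cocycles\<close>

context comm_group
begin

context
  fixes K :: "'x::ab_group_add set" and t :: "'a \<Rightarrow> 'a \<Rightarrow> 'x"
  assumes K: "difference_closed K"
    and left: "\<And>x y z. \<lbrakk>x \<in> carrier G; y \<in> carrier G; z \<in> carrier G\<rbrakk>
      \<Longrightarrow> t (x \<otimes> y) z - t x z - t y z \<in> K"
    and right: "\<And>x y z. \<lbrakk>x \<in> carrier G; y \<in> carrier G; z \<in> carrier G\<rbrakk>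
      \<Longrightarrow> t x (y \<otimes> z) - t x y - t x z \<in> K"
begin

interpretation K: difference_closed K by (fact K)

lemma bilinear_one_left:
  assumes "x \<in> carrier G" shows "t \<one> x \<in> K"
  using left [of \<one> \<one> x] assms K.uminus_mem by fastforce

lemma bilinear_one_right:
  assumes "x \<in> carrier G" shows "t x \<one> \<in> K"
  using right [of x \<one> \<one>] assms K.uminus_mem by fastforce

lemma bilinear_inv_left:
  assumes [simp]: "x \<in> carrier G" "z \<in> carrier G" shows "t (inv x) z + t x z \<in> K"
proof -
  have "t (inv x) z + t x z = t (inv x \<otimes> x) z - (t (inv x \<otimes> x) z - t (inv x) z - t x z)" by simp
  also have "\<dots> \<in> K" by (intro K.diff_mem left) (simp_all add: bilinear_one_left)
  finally show ?thesis .
qed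

lemma bilinear_inv_right:
  assumes [simp]: "x \<in> carrier G" "z \<in> carrier G" shows "t z (inv x) + t z x \<in> K"
proof -
  have "t z (inv x) + t z x = t z (inv x \<otimes> x) - (t z (inv x \<otimes> x) - t z (inv x) - t z x)" by simp
  also have "\<dots> \<in> K" by (intro K.diff_mem right) (simp_all add: bilinear_one_right)
  finally show ?thesis .
qed

lemma bilinear_tak_left:
  assumes [simp]: "a \<in> carrier G" "c \<in> carrier G" "z \<in> carrier G"
  shows "t (a \<bowtie> c) z - (t c z + t c z - t a z) \<in> K"
proof -
  have "t (a \<bowtie> c) z - (t c z + t c z - t a z) =
    (t (c \<otimes> c \<otimes> inv a) z - t (c \<otimes> c) z - t (inv a) z) + (t (c \<otimes> c) z - t c z - t c z)
    + (t (inv a) z + t a z)"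
    by (simp add: qop_takasaki)
  also have "\<dots> \<in> K" by (intro K.add_mem left bilinear_inv_left) simp_all
  finally show ?thesis .
qed

lemma bilinear_tak_right:
  assumes [simp]: "a \<in> carrier G" "c \<in> carrier G" "z \<in> carrier G"
  shows "t z (a \<bowtie> c) - (t z c + t z c - t z a) \<in> K"
proof -
  have "t z (a \<bowtie> c) - (t z c + t z c - t z a) =
    (t z (c \<otimes> c \<otimes> inv a) - t z (c \<otimes> c) - t z (inv a)) + (t z (c \<otimes> c) - t z c - t z c)
    + (t z (inv a) + t z a)"
    by (simp add: qop_takasaki)
  also have "\<dots> \<in> K" by (intro K.add_mem right bilinear_inv_right) simp_all
  finally show ?thesis .
qed

context
  assumes diag: "\<And>x. x \<in> carrier G \<Longrightarrow> t x x \<in> K"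
begin

lemma bilinear_antisym:
  assumes [simp]: "b \<in> carrier G" "c \<in> carrier G" shows "t b c + t c b \<in> K"
proof -
  have "t b c + t c b = t (b \<otimes> c) (b \<otimes> c) - (t (b \<otimes> c) (b \<otimes> c) - t b (b \<otimes> c) - t c (b \<otimes> c))
    - (t b (b \<otimes> c) - t b b - t b c) - (t c (b \<otimes> c) - t c b - t c c) - t b b - t c c"
    by simp
  also have "\<dots> \<in> K" by (intro K.diff_mem left right diag) simp_all
  finally show ?thesis .
qed

text \<open>Written additively, expanding \<open>t(2c - a, 2c - b)\<close> and
  \<open>t(2b - a, c)\<close> leaves \<open>4 t(c, c) - 2 (t(b, c) + t(c, b))\<close>, which
  vanishes for an alternating map.\<close>

lemma bilinear_takasaki_cocycle:
  assumes [simp]: "a \<in> carrier G" "b \<in> carrier G" "c \<in> carrier G"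
  shows "t a c + t (a \<bowtie> c) (b \<bowtie> c)
        - t a b - t (a \<bowtie> b) c \<in> K"
proof -
  let ?ac = "a \<bowtie> c" and ?bc = "b \<bowtie> c" and ?ab = "a \<bowtie> b"
  let ?r = "t c ?bc - (t c c + t c c - t c b)"
  have "t a c + t ?ac ?bc - t a b - t ?ab c =
    (t ?ac ?bc - (t c ?bc + t c ?bc - t a ?bc)) + ?r + ?r - (t a ?bc - (t a c + t a c - t a b))
    + t c c + t c c + t c c + t c c - (t b c + t c b) - (t b c + t c b)
    - (t ?ab c - (t b c + t b c - t a c))"
    by (simp add: algebra_simps)
  also have "\<dots> \<in> K"
    by (intro bilinear_tak_left bilinear_tak_right diag bilinear_antisym K.mem_intros) simp_all
  finally show ?thesis .
qed

end

end

end

section \<open>The second homology of a Takasaki quandle\<close>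

text \<open>Adding to \<open>(a, b)\<close> the chain \<open>(0, a/2) - (0, (a * b)/2)\<close>, whose boundary is \<open>a * b - a\<close>,
  retracts the \<open>2\<close>-chains onto the cycles. The retracted generators are bilinear modulo null chains,
  so they factor through the exterior square.\<close>

locale odd_abelian_group = comm_group G for G (structure) +
  assumes finite: "finite (carrier G)" and odd: "odd (order G)"
begin

sublocale Q: quandle "takasaki G" by (rule quandle_takasaki_group)

section \<open>Halving in a group of odd order\<close>

definition half :: "'a \<Rightarrow> 'a" where "half x = x [^] (Suc (order G) div 2)"

lemma half_closed [simp]: "x \<in> carrier G \<Longrightarrow> half x \<in> carrier G"
  by (simp add: half_def)

text \<open>The exponent is half of \<open>Suc (order G)\<close>, an inverse of 2 modulo the odd
  order.\<close>

lemma half_mult_half: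
  assumes "x \<in> carrier G" shows "half x \<otimes> half x = x"
proof -
  have "half x \<otimes> half x = x [^] (Suc (order G) div 2 + Suc (order G) div 2)"
    using assms by (simp add: half_def nat_pow_mult)
  also have "Suc (order G) div 2 + Suc (order G) div 2 = Suc (order G)"
    using odd by presburger
  finally show ?thesis using assms by (simp add: pow_order_eq_1)
qed

lemma half_mult: "x \<in> carrier G \<Longrightarrow> y \<in> carrier G \<Longrightarrow> half (x \<otimes> y) = half x \<otimes> half y"
  by (simp add: half_def pow_mult_distrib m_comm)

lemma half_double: "x \<in> carrier G \<Longrightarrow> half (x \<otimes> x) = x"
  by (simp add: half_mult half_mult_half)

lemma one_tak_half: "x \<in> carrier G \<Longrightarrow> \<one> \<bowtie> half x = x"
  by (simp add: qop_takasaki half_mult_half)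

section \<open>Maps between pairs and cycles\<close>

definition cycle_of_pair :: "'a \<Rightarrow> 'a \<Rightarrow> 'a list \<Rightarrow>\<^sub>0 int"
  where "cycle_of_pair a b = frag_of [a, b] + frag_of [\<one>, half a] - frag_of [\<one>, half (a \<bowtie> b)]"

definition cycle_of_pairs :: "('a \<times> 'a \<Rightarrow>\<^sub>0 int) \<Rightarrow> ('a list \<Rightarrow>\<^sub>0 int)"
  where "cycle_of_pairs = frag_extend (\<lambda>(a, b). cycle_of_pair a b)"

definition pairs_of_chain :: "('a list \<Rightarrow>\<^sub>0 int) \<Rightarrow> ('a \<times> 'a \<Rightarrow>\<^sub>0 int)"
  where "pairs_of_chain = frag_extend (\<lambda>xs. frag_of (xs ! 0, xs ! 1))"

lemma frag_of_chain: "frag_of xs \<in> carrier (rack_chain_group (takasaki G) n) \<longleftrightarrow> length xs = n \<and> set xs \<subseteq> carrier G"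
  by (simp add: carrier_rack_chain_group tuples_def)

lemma chain_induct [consumes 1, case_names zero pair diff]:
  assumes "c \<in> carrier (rack_chain_group (takasaki G) 2)"
    and "P 0" and "\<And>a b. a \<in> carrier G \<Longrightarrow> b \<in> carrier G \<Longrightarrow> P (frag_of [a, b])"
    and "\<And>x y. P x \<Longrightarrow> P y \<Longrightarrow> P (x - y)"
  shows "P c"
proof -
  have "Poly_Mapping.keys c \<subseteq> tuples (takasaki G) 2" using assms(1) by (simp add: carrier_rack_chain_group)
  then show ?thesis
  proof (induction c rule: frag_induction)
    case (one xs)
    then obtain a b where "xs = [a, b]" "a \<in> carrier G" "b \<in> carrier G"
      by (auto simp: tuples_def length_Suc_conv numeral_2_eq_2)
    then show ?case using assms(3) by simp
  qed (use assms in auto)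
qed

lemma pairs_induct [consumes 1, case_names zero pair diff]:
  assumes "c \<in> carrier pair_group"
    and "P 0" and "\<And>a b. a \<in> carrier G \<Longrightarrow> b \<in> carrier G \<Longrightarrow> P (frag_of (a, b))"
    and "\<And>x y. P x \<Longrightarrow> P y \<Longrightarrow> P (x - y)"
  shows "P c"
proof -
  have "Poly_Mapping.keys c \<subseteq> carrier G \<times> carrier G" using assms(1) by simp
  then show ?thesis
    by (induction c rule: frag_induction) (use assms in auto)
qed

lemma cycle_of_pair_cycle:
  assumes [simp]: "a \<in> carrier G" "b \<in> carrier G" shows "cycle_of_pair a b \<in> Q.rack_cycles"
proof -
  interpret C: difference_closed "carrier (rack_chain_group (takasaki G) 2)"
    by (rule Q.difference_closed_rack_chains)
  have "frag_of [x, y] \<in> carrier (rack_chain_group (takasaki G) 2)" if "x \<in> carrier G" "y \<in> carrier G" for x y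
    using that by (simp add: frag_of_chain)
  then have "cycle_of_pair a b \<in> carrier (rack_chain_group (takasaki G) 2)"
    unfolding cycle_of_pair_def by (intro C.diff_mem C.add_mem) simp_all
  then show ?thesis
    by (simp add: Q.rack_cycles_def cycle_of_pair_def Q.rack_boundary_simps rack_boundary_2 one_tak_half)
qed

lemma cycle_of_pairs_cycle:
  assumes "z \<in> carrier pair_group" shows "cycle_of_pairs z \<in> Q.rack_cycles"
proof -
  interpret Z: difference_closed Q.rack_cycles
    using difference_closed_subgroup Q.subgroup_rack_cycles unfolding rack_chain_group_def by blast
  show ?thesis using assms
    by (induction z rule: pairs_induct)
      (auto simp: cycle_of_pairs_def frag_extend_diff Z.zero_mem Z.diff_mem cycle_of_pair_cycle)
qed

text \<open>The correction terms of a chain depend only on its boundary: they arise by sending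
  \<open>[a]\<close> to \<open>[\<one>, half a]\<close>. On a cycle they add up to 0.\<close>

lemma cycle_of_pairs_of_chain:
  assumes "c \<in> Q.rack_cycles" shows "cycle_of_pairs (pairs_of_chain c) = c"
proof -
  let ?s = "frag_extend (\<lambda>xs. frag_of [\<one>, half (xs ! 0)])"
  have "c \<in> carrier (rack_chain_group (takasaki G) 2)" using assms by (simp add: Q.rack_cycles_def)
  then have "cycle_of_pairs (pairs_of_chain c) = c + ?s (rack_boundary (takasaki G) c)"
  proof (induction c rule: chain_induct)
    case (pair a b)
    then show ?case
      by (simp add: cycle_of_pairs_def pairs_of_chain_def cycle_of_pair_def rack_boundary_2 frag_extend_diff)
  next
    case (diff x y)
    then show ?case
      by (simp add: cycle_of_pairs_def pairs_of_chain_def frag_extend_diff Q.rack_boundary_simps)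
  qed (simp add: cycle_of_pairs_def pairs_of_chain_def Q.rack_boundary_simps)
  with assms show ?thesis by (simp add: Q.rack_cycles_def)
qed

text \<open>Modulo null chains, \<open>cycle_of_pair\<close> is a cocycle with both normalizations,
  hence bilinear and alternating. The universal property then applies.\<close>

lemma cycle_of_pairs_null:
  assumes "z \<in> wedge_kernel" shows "cycle_of_pairs z \<in> Q.null_chains"
proof -
  note K = Q.difference_closed_null_chains
  have diag: "cycle_of_pair a a \<in> Q.null_chains" if "a \<in> carrier G" for a
    using that Q.degenerate_null [OF Q.diagonal_degenerate] Q.idem [of a] by (simp add: cycle_of_pair_def)
  \<comment> \<open>As \<open>half (\<one> \<bowtie> b) = b\<close>, the last correction cancels
    \<open>[\<one>, b]\<close> and leaves the degenerate \<open>[\<one>, \<one>]\<close>. The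
    corrections are chosen to achieve this.\<close>
  have one: "cycle_of_pair \<one> b \<in> Q.null_chains" if "b \<in> carrier G" for b
    using that Q.degenerate_null [OF Q.diagonal_degenerate, of \<one>] half_double [of \<one>] half_double [of b]
    by (simp add: cycle_of_pair_def qop_takasaki)
  \<comment> \<open>The corrections telescope, by self-distributivity, and leave the boundary of
    \<open>[a, b, c]\<close>.\<close>
  have coc: "cycle_of_pair a c + cycle_of_pair (a \<bowtie> c) (b \<bowtie> c) - cycle_of_pair a b - cycle_of_pair (a \<bowtie> b) c
      \<in> Q.null_chains" if "a \<in> carrier G" "b \<in> carrier G" "c \<in> carrier G" for a b c
  proof -
    have "frag_of [a, b, c] \<in> carrier (rack_chain_group (takasaki G) 3)"
      using that by (simp add: frag_of_chain)
    from Q.boundary_null [OF this] show ?thesis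
      using that Q.distrib [of a b c] by (simp add: rack_boundary_3 cycle_of_pair_def algebra_simps)
  qed
  have div: "\<exists>b\<in>carrier G. a = b \<otimes> b" if "a \<in> carrier G" for a
    using that half_mult_half [OF that] by (metis half_closed)
  show ?thesis
    unfolding cycle_of_pairs_def
  proof (rule wedge_kernel_universal [OF K _ _ _ assms], goal_cases)
    case (1 x y z)
    then show ?case using takasaki_cocycle_bilinear_left [where s = cycle_of_pair, OF K diag one coc div] by simp
  next
    case (2 x y z)
    then show ?case using takasaki_cocycle_bilinear_right [where s = cycle_of_pair, OF K diag one coc div] by simp
  next
    case (3 x)
    then show ?case using diag by simp
  qed
qed

abbreviation pair_class where "pair_class a b \<equiv> frag_of (a, b) :: 'a \<times> 'a \<Rightarrow>\<^sub>0 int"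

lemma pairs_of_chain_hom: "pairs_of_chain \<in> hom (rack_chain_group (takasaki G) 2) pair_group"
proof (rule homI)
  fix c assume "c \<in> carrier (rack_chain_group (takasaki G) 2)"
  then show "pairs_of_chain c \<in> carrier pair_group"
  proof (induction c rule: chain_induct)
    case (diff x y)
    then show ?case using keys_diff by (fastforce simp: pairs_of_chain_def frag_extend_diff)
  qed (simp_all add: pairs_of_chain_def)
qed (simp add: pairs_of_chain_def rack_chain_group_def frag_extend_add)

text \<open>Degenerate generators become squares \<open>x \<and> x\<close> in the exterior square,
  and the boundary of a triple becomes the cocycle identity of the universal alternating
  map.\<close>

lemma pairs_of_null_chain:
  assumes "c \<in> Q.null_chains" shows "pairs_of_chain c \<in> wedge_kernel"
proof -
  interpret W: difference_closed wedge_kernel by (rule difference_closed_wedge_kernel)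
  interpret wedge: group_hom pair_group "exterior_square G" "wedge_proj G"
    using wedge_proj_hom group_exterior_square by (simp add: group_hom_def group_hom_axioms_def)
  obtain d y where c: "c = d + rack_boundary (takasaki G) y"
    and d: "d \<in> degenerate_chains (takasaki G) 2" and y: "y \<in> carrier (rack_chain_group (takasaki G) 3)"
    using assms by (auto simp: Q.null_chains_def)
  have "pairs_of_chain ` degenerate_chains (takasaki G) 2 \<subseteq> wedge_kernel"
    unfolding Q.degenerate_chains_2
  proof (rule hom_generate_subset [OF pairs_of_chain_hom])
    show "pairs_of_chain ` {frag_of [a, a] | a. a \<in> carrier (takasaki G)} \<subseteq> wedge_kernel"
      using wedge_kernel_diagonal by (auto simp: pairs_of_chain_def)
  qed (auto simp: frag_of_chain wedge.subgroup_kernel comm_group.axioms(2) comm_group_rack_chain_group)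
  then have "pairs_of_chain d \<in> wedge_kernel" using d by blast
  moreover have "pairs_of_chain (rack_boundary (takasaki G) y) \<in> wedge_kernel"
  proof -
    have "Poly_Mapping.keys y \<subseteq> tuples (takasaki G) 3" using y by (simp add: carrier_rack_chain_group)
    then show ?thesis
    proof (induction y rule: frag_induction)
      case (one xs)
      then obtain a b c where xs: "xs = [a, b, c]" "a \<in> carrier G" "b \<in> carrier G" "c \<in> carrier G"
        by (auto simp: tuples_def length_Suc_conv numeral_3_eq_3)
      then show ?case
        using bilinear_takasaki_cocycle [where t = pair_class, OF difference_closed_wedge_kernel
            wedge_kernel_bilinear wedge_kernel_diagonal, of a b c]
        by (simp add: rack_boundary_3 pairs_of_chain_def frag_extend_add frag_extend_diff)
    qed (simp_all add: Q.rack_boundary_simps pairs_of_chain_def frag_extend_diff W.zero_mem W.diff_mem)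
  qed
  ultimately show ?thesis by (simp add: c pairs_of_chain_def frag_extend_add W.add_mem)
qed

text \<open>The correction terms have \<open>\<one>\<close> as first entry, so they die in the
  exterior square.\<close>

lemma pairs_of_cycle_of_pairs:
  assumes "z \<in> carrier pair_group"
  shows "pairs_of_chain (cycle_of_pairs z) - z \<in> wedge_kernel"
proof -
  interpret W: difference_closed wedge_kernel by (rule difference_closed_wedge_kernel)
  have one: "frag_of (\<one>, x) \<in> wedge_kernel" if "x \<in> carrier G" for x
    using bilinear_one_left [where t = pair_class, OF difference_closed_wedge_kernel wedge_kernel_bilinear] that by blast
  show ?thesis using assms
  proof (induction z rule: pairs_induct)
    case (pair a b)
    have "frag_of (\<one>, half a) - frag_of (\<one>, half (a \<bowtie> b)) \<in> wedge_kernel"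
      using pair by (intro W.diff_mem one) simp_all
    then show ?case
      by (simp add: cycle_of_pairs_def pairs_of_chain_def cycle_of_pair_def frag_extend_add frag_extend_diff)
  next
    case (diff x y)
    from W.diff_mem [OF diff] show ?case
      by (simp add: cycle_of_pairs_def pairs_of_chain_def frag_extend_diff algebra_simps)
  qed (simp add: cycle_of_pairs_def pairs_of_chain_def W.zero_mem)
qed

theorem homology_2_takasaki: "quandle_homology 2 (takasaki G) \<cong> exterior_square G"
proof (rule iso_of_same_kernel)
  interpret wedge: group_hom pair_group "exterior_square G" "wedge_proj G"
    using wedge_proj_hom group_exterior_square by (simp add: group_hom_def group_hom_axioms_def)
  let ?g = "\<lambda>c. wedge_proj G (pairs_of_chain c)"
  show "Q.homology_class \<in> hom Q.cycle_monoid (quandle_homology 2 (takasaki G))"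
    by (rule Q.homology_class_hom)
  show "Q.homology_class ` carrier Q.cycle_monoid = carrier (quandle_homology 2 (takasaki G))"
    by (rule Q.homology_class_surj)
  show "group Q.cycle_monoid" by (rule Q.group_cycle_monoid)
  show "group (quandle_homology 2 (takasaki G))"
    by (rule comm_group.axioms(2) [OF Q.comm_group_quandle_homology_2])
  show "group (exterior_square G)" by (rule group_exterior_square)
  have cycles: "Q.rack_cycles \<subseteq> carrier (rack_chain_group (takasaki G) 2)"
    by (auto simp: Q.rack_cycles_def)
  have "?g \<in> hom (rack_chain_group (takasaki G) 2) (exterior_square G)"
    using Group.hom_compose [OF pairs_of_chain_hom wedge_proj_hom] by (simp add: o_def)
  note g' = this
  show g: "?g \<in> hom Q.cycle_monoid (exterior_square G)"
  proof (rule homI)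
    fix x y assume "x \<in> carrier Q.cycle_monoid" "y \<in> carrier Q.cycle_monoid"
    then have "x \<in> carrier (rack_chain_group (takasaki G) 2)" "y \<in> carrier (rack_chain_group (takasaki G) 2)"
      using cycles by auto
    then show "?g x \<in> carrier (exterior_square G)"
      "?g (x \<otimes>\<^bsub>Q.cycle_monoid\<^esub> y) = ?g x \<otimes>\<^bsub>exterior_square G\<^esub> ?g y"
      using hom_in_carrier [OF g'] hom_mult [OF g'] by simp_all
  qed
  show "?g ` carrier Q.cycle_monoid = carrier (exterior_square G)"
  proof
    show "?g ` carrier Q.cycle_monoid \<subseteq> carrier (exterior_square G)"
      using hom_carrier [OF g] .
    show "carrier (exterior_square G) \<subseteq> ?g ` carrier Q.cycle_monoid"
    proof
      fix A assume "A \<in> carrier (exterior_square G)"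
      then obtain z where z: "z \<in> carrier pair_group" "A = wedge_proj G z"
        using wedge_proj_surj by blast
      \<comment> \<open>The projection kills \<open>?k\<close>, so \<open>z\<close> may be replaced
        by the pairs of a genuine cycle.\<close>
      let ?k = "pairs_of_chain (cycle_of_pairs z) - z"
      have k: "?k \<in> carrier pair_group" "wedge_proj G ?k = \<one>\<^bsub>exterior_square G\<^esub>"
        using pairs_of_cycle_of_pairs [OF z(1)] by (auto simp: kernel_def)
      have "wedge_proj G (?k \<otimes>\<^bsub>pair_group\<^esub> z) = A"
        using wedge.hom_mult [OF k(1) z(1)] k(2) z wedge.hom_closed by simp
      then have "A = ?g (cycle_of_pairs z)" by simp
      with cycle_of_pairs_cycle [OF z(1)] show "A \<in> ?g ` carrier Q.cycle_monoid" by simp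
    qed
  qed
  show "kernel Q.cycle_monoid (quandle_homology 2 (takasaki G)) Q.homology_class
      = kernel Q.cycle_monoid (exterior_square G) ?g"
    unfolding Q.homology_class_kernel
  proof
    show "Q.null_chains \<subseteq> kernel Q.cycle_monoid (exterior_square G) ?g"
      using pairs_of_null_chain Q.homology_class_kernel by (auto simp: kernel_def)
    show "kernel Q.cycle_monoid (exterior_square G) ?g \<subseteq> Q.null_chains"
    proof
      fix c assume c: "c \<in> kernel Q.cycle_monoid (exterior_square G) ?g"
      then have "c \<in> Q.rack_cycles" by (simp add: kernel_def)
      moreover from c have "pairs_of_chain c \<in> wedge_kernel"
        using hom_in_carrier [OF pairs_of_chain_hom] cycles by (auto simp: kernel_def)
      \<comment> \<open>A cycle is recovered exactly from its pairs, so relations among the pairs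
        carry back to null chains.\<close>
      ultimately show "c \<in> Q.null_chains"
        using cycle_of_pairs_null cycle_of_pairs_of_chain by metis
    qed
  qed
qed

end

section \<open>The exterior square of a power of a cyclic group\<close>

lemma difference_closed_dvd: "difference_closed {m :: 'b \<Rightarrow>\<^sub>0 int. \<forall>p. k dvd Poly_Mapping.lookup m p}"
  by unfold_locales (simp_all add: lookup_minus)

section \<open>Expansion in unit vectors\<close>

definition unit_vec :: "nat \<Rightarrow> nat \<Rightarrow> int" where "unit_vec i = (\<lambda>j. if j = i then 1 else 0)"

context
  fixes K :: "('b \<Rightarrow>\<^sub>0 int) set" and f :: "(nat \<Rightarrow> int) \<Rightarrow> ('b \<Rightarrow>\<^sub>0 int)"
  assumes K: "difference_closed K"
    and add: "\<And>u v. f (\<lambda>i. u i + v i) - f u - f v \<in> K"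
begin

interpretation K: difference_closed K by (fact K)

lemma additive_zero: "f (\<lambda>i. 0) \<in> K"
  using add [of "\<lambda>i. 0" "\<lambda>i. 0"] K.uminus_mem by fastforce

lemma additive_multiple: "f (\<lambda>j. m * u j) - frag_cmul m (f u) \<in> K"
proof (induction m rule: int_induct [of _ 0])
  case base
  then show ?case by (simp add: additive_zero)
next
  case (step1 m)
  from K.add_mem [OF add [of "\<lambda>j. m * u j" u] step1(2)] show ?case
    by (simp add: frag_cmul_distrib algebra_simps)
next
  case (step2 m)
  from K.diff_mem [OF step2(2) add [of "\<lambda>j. (m - 1) * u j" u]] show ?case
    by (simp add: frag_cmul_diff_distrib algebra_simps)
qed

text \<open>Vectors are functions on all natural numbers, so only a truncation is a finite
  combination of unit vectors. After reduction into the group the truncation is invisible, by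
  \<open>reduce_truncate\<close>.\<close>

lemma additive_expansion:
  "f (\<lambda>i. if i < n then u i else 0) - (\<Sum>i<n. frag_cmul (u i) (f (unit_vec i))) \<in> K"
proof (induction n)
  case 0
  then show ?case by (simp add: additive_zero)
next
  case (Suc n)
  let ?t = "\<lambda>n i. if i < n then u i else 0"
  have "?t (Suc n) = (\<lambda>i. ?t n i + u n * unit_vec n i)"
    by (auto simp: fun_eq_iff unit_vec_def less_Suc_eq)
  then have "f (?t (Suc n)) - (\<Sum>i<Suc n. frag_cmul (u i) (f (unit_vec i))) =
    (f (\<lambda>i. ?t n i + u n * unit_vec n i) - f (?t n) - f (\<lambda>i. u n * unit_vec n i))
    + (f (?t n) - (\<Sum>i<n. frag_cmul (u i) (f (unit_vec i))))
    + (f (\<lambda>i. u n * unit_vec n i) - frag_cmul (u n) (f (unit_vec n)))"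
    by simp
  also have "\<dots> \<in> K" by (intro K.add_mem add Suc additive_multiple)
  finally show ?case .
qed

end

lemma (in difference_closed) double_sum_mem:
  fixes n :: nat
  assumes "\<And>i. F i i \<in> K"
  shows "(\<Sum>i<n. \<Sum>j<n. F i j) - (\<Sum>j<n. \<Sum>i<j. F i j + F j i) \<in> K"
proof (induction n)
  case (Suc n)
  have "(\<Sum>i<Suc n. \<Sum>j<Suc n. F i j) - (\<Sum>j<Suc n. \<Sum>i<j. F i j + F j i)
      = (\<Sum>i<n. \<Sum>j<n. F i j) - (\<Sum>j<n. \<Sum>i<j. F i j + F j i) + F n n"
    by (simp add: sum.distrib)
  also have "\<dots> \<in> K" by (intro add_mem Suc assms)
  finally show ?case .
qed (simp add: zero_mem)

lemma card_ordered_pairs: "finite {(i, j). i < j \<and> j < n}" "card {(i, j). i < j \<and> j < (n::nat)} = n choose 2"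
proof -
  have eq: "{(i, j). i < j \<and> j < n} = (\<lambda>(j, i). (i, j)) ` (SIGMA j:{..<n}. {..<j})" by auto
  show "finite {(i, j). i < j \<and> j < n}" unfolding eq by (intro finite_imageI finite_SigmaI) auto
  have "card {(i, j). i < j \<and> j < n} = card (SIGMA j:{..<n}. {..<j})"
    unfolding eq by (rule card_image) (auto simp: inj_on_def)
  also have "\<dots> = (\<Sum>j<n. j)" by simp
  also have "\<dots> = n choose 2" by (induction n) (simp_all add: numeral_2_eq_2)
  finally show "card {(i, j). i < j \<and> j < n} = n choose 2" .
qed

text \<open>The Pluecker coordinates of a pair, kept as integers; they are compared only modulo
  \<open>k\<close>.\<close>

definition minors :: "nat \<Rightarrow> (nat \<Rightarrow> int) \<times> (nat \<Rightarrow> int) \<Rightarrow> (nat \<times> nat \<Rightarrow>\<^sub>0 int)"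
  where "minors n = (\<lambda>(x, y). \<Sum>j<n. \<Sum>i<j. frag_cmul (x i * y j - x j * y i) (frag_of (i, j)))"

lemma lookup_minors:
  "Poly_Mapping.lookup (minors n (x, y)) (i, j) = (if i < j \<and> j < n then x i * y j - x j * y i else 0)"
proof -
  have "Poly_Mapping.lookup (frag_cmul c (frag_of (a, b))) (i, j)
      = (if a = i then if b = j then c else 0 else 0)" for a b c
    by (auto simp: when_def)
  then have "Poly_Mapping.lookup (minors n (x, y)) (i, j)
      = (\<Sum>b<n. \<Sum>a<b. if a = i then if b = j then x a * y b - x b * y a else 0 else 0)"
    by (simp only: minors_def case_prod_conv lookup_sum)
  also have "\<dots> = (\<Sum>b<n. if b = j then if i < j then x i * y j - x j * y i else 0 else 0)"
    by (intro sum.cong refl) auto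
  finally show ?thesis by simp
qed

context
  fixes k n :: nat
  assumes k: "k > 0"
begin

interpretation C: comm_group "cyclic_power k n" by (rule comm_group_cyclic_power)

interpretation W: difference_closed C.wedge_kernel by (rule C.difference_closed_wedge_kernel)

text \<open>Projects integer vectors onto the group. Additivity and integer multiples are handled on
  the unreduced vectors, whose coefficients are genuine integers.\<close>

definition reduce :: "(nat \<Rightarrow> int) \<Rightarrow> nat \<Rightarrow> int"
  where "reduce u = (\<lambda>i\<in>{..<n}. u i mod int k)"

lemma carrier_cyclic_power: "carrier (cyclic_power k n) = (\<Pi>\<^sub>E i\<in>{..<n}. {0..<int k})"
  using k by (simp add: cyclic_power_def carrier_integer_mod_group)

lemma mult_cyclic_power: "x \<otimes>\<^bsub>cyclic_power k n\<^esub> y = (\<lambda>i\<in>{..<n}. (x i + y i) mod int k)"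
  by (simp add: cyclic_power_def)

lemma one_cyclic_power: "\<one>\<^bsub>cyclic_power k n\<^esub> = (\<lambda>i\<in>{..<n}. 0)"
  by (simp add: cyclic_power_def)

lemma reduce_closed: "reduce u \<in> carrier (cyclic_power k n)"
  using k by (simp add: carrier_cyclic_power reduce_def)

lemma reduce_carrier: "x \<in> carrier (cyclic_power k n) \<Longrightarrow> reduce x = x"
  by (auto simp: carrier_cyclic_power reduce_def fun_eq_iff PiE_iff extensional_def)

lemma reduce_add: "reduce (\<lambda>i. u i + v i) = reduce u \<otimes>\<^bsub>cyclic_power k n\<^esub> reduce v"
  by (simp add: mult_cyclic_power reduce_def fun_eq_iff mod_add_eq)

lemma reduce_multiple: "reduce (\<lambda>i. int k * u i) = \<one>\<^bsub>cyclic_power k n\<^esub>"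
  by (simp add: one_cyclic_power reduce_def fun_eq_iff)

lemma reduce_truncate: "reduce (\<lambda>i. if i < n then u i else 0) = reduce u"
  by (simp add: reduce_def fun_eq_iff)

abbreviation red_pair :: "(nat \<Rightarrow> int) \<Rightarrow> (nat \<Rightarrow> int) \<Rightarrow> ((nat \<Rightarrow> int) \<times> (nat \<Rightarrow> int) \<Rightarrow>\<^sub>0 int)"
  where "red_pair u v \<equiv> frag_of (reduce u, reduce v)"

lemma red_pair_add:
  "red_pair (\<lambda>i. u i + v i) w - red_pair u w - red_pair v w \<in> C.wedge_kernel"
  "red_pair w (\<lambda>i. u i + v i) - red_pair w u - red_pair w v \<in> C.wedge_kernel"
  by (simp_all only: reduce_add) (intro C.wedge_kernel_bilinear reduce_closed)+

lemma red_pair_antisym: "red_pair u v + red_pair v u \<in> C.wedge_kernel"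
  using C.bilinear_antisym [where t = "\<lambda>x y. frag_of (x, y)", OF W.difference_closed_axioms
    C.wedge_kernel_bilinear C.wedge_kernel_diagonal reduce_closed reduce_closed] .

definition basis_wedge :: "(nat \<times> nat \<Rightarrow>\<^sub>0 int) \<Rightarrow> ((nat \<Rightarrow> int) \<times> (nat \<Rightarrow> int) \<Rightarrow>\<^sub>0 int)"
  where "basis_wedge = frag_extend (\<lambda>(i, j). red_pair (unit_vec i) (unit_vec j))"

text \<open>Expand both arguments in unit vectors, drop the diagonal terms, and collect the two
  orders of each pair \<open>i < j\<close> into one.\<close>

lemma red_pair_expansion: "red_pair u v - basis_wedge (minors n (u, v)) \<in> C.wedge_kernel"
proof -
  note cmul = frag_cmul_mem [OF W.difference_closed_axioms]
  have cmul_diff: "frag_cmul m (x - y) = frag_cmul m x - frag_cmul m y"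
    for m and x y :: "(nat \<Rightarrow> int) \<times> (nat \<Rightarrow> int) \<Rightarrow>\<^sub>0 int"
    by (rule poly_mapping_eqI) (simp add: lookup_minus algebra_simps)
  let ?e = "\<lambda>i j. red_pair (unit_vec i) (unit_vec j)"
  let ?F = "\<lambda>i j. frag_cmul (u i * v j) (?e i j)"
  have 1: "red_pair u v - (\<Sum>i<n. frag_cmul (u i) (red_pair (unit_vec i) v)) \<in> C.wedge_kernel"
    using additive_expansion [where f = "\<lambda>u. red_pair u v", OF W.difference_closed_axioms red_pair_add(1), of n u]
    by (simp add: reduce_truncate)
  have "red_pair (unit_vec i) v - (\<Sum>j<n. frag_cmul (v j) (?e i j)) \<in> C.wedge_kernel" for i
    using additive_expansion [where f = "red_pair (unit_vec i)", OF W.difference_closed_axioms red_pair_add(2), of n v]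
    by (simp add: reduce_truncate)
  from W.sum_mem [OF cmul [OF this]]
  have 2: "(\<Sum>i<n. frag_cmul (u i) (red_pair (unit_vec i) v)) - (\<Sum>i<n. \<Sum>j<n. ?F i j) \<in> C.wedge_kernel"
    by (simp add: cmul_diff frag_cmul_sum sum_subtractf)
  have 3: "(\<Sum>i<n. \<Sum>j<n. ?F i j) - (\<Sum>j<n. \<Sum>i<j. ?F i j + ?F j i) \<in> C.wedge_kernel"
    by (intro W.double_sum_mem cmul C.wedge_kernel_diagonal reduce_closed)
  \<comment> \<open>The minor carries \<open>u j * v i\<close> with a minus sign on
    \<open>?e i j\<close>, where the expansion has it on \<open>?e j i\<close>; the discrepancy is a
    multiple of the antisymmetry relation.\<close>
  have "(\<Sum>j<n. \<Sum>i<j. ?F i j + ?F j i) - basis_wedge (minors n (u, v))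
      = (\<Sum>j<n. \<Sum>i<j. frag_cmul (u j * v i) (?e i j + ?e j i))"
    by (simp add: basis_wedge_def minors_def frag_extend_sum frag_extend_cmul frag_extend_diff
        frag_cmul_diff_distrib frag_cmul_distrib2 sum_subtractf [symmetric]
        minus_frag_cmul [symmetric] add.commute del: minus_frag_cmul)
  also have "\<dots> \<in> C.wedge_kernel"
    by (intro W.sum_mem cmul red_pair_antisym)
  finally have 4: "(\<Sum>j<n. \<Sum>i<j. ?F i j + ?F j i) - basis_wedge (minors n (u, v)) \<in> C.wedge_kernel" .
  show ?thesis
    by (rule W.diff_trans [OF W.diff_trans [OF W.diff_trans [OF 1 2] 3] 4])
qed

definition coordinates where "coordinates = frag_extend (minors n)"

lemma basis_wedge_coordinates:
  assumes "z \<in> carrier C.pair_group"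
  shows "z - basis_wedge (coordinates z) \<in> C.wedge_kernel"
proof -
  have "Poly_Mapping.keys z \<subseteq> carrier (cyclic_power k n) \<times> carrier (cyclic_power k n)" using assms by simp
  then show ?thesis
  proof (induction z rule: frag_induction)
    case (one p)
    then obtain x y where "p = (x, y)" "x \<in> carrier (cyclic_power k n)" "y \<in> carrier (cyclic_power k n)" by auto
    with red_pair_expansion [of x y] show ?case by (simp add: reduce_carrier coordinates_def)
  next
    case (diff x y)
    from W.diff_mem [OF this] show ?case
      by (simp add: coordinates_def basis_wedge_def frag_extend_diff algebra_simps)
  qed (simp add: coordinates_def basis_wedge_def W.zero_mem)
qed

text \<open>Since \<open>k\<close> times a unit vector reduces to the identity, \<open>k\<close>
  times a basis wedge is a relation.\<close>

lemma basis_wedge_dvd: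
  assumes "\<And>p. int k dvd Poly_Mapping.lookup m p"
  shows "basis_wedge m \<in> C.wedge_kernel"
  unfolding basis_wedge_def frag_extend_def
proof (intro W.sum_mem)
  fix p :: "nat \<times> nat"
  obtain i j where p: "p = (i, j)" by fastforce
  obtain q where q: "Poly_Mapping.lookup m p = q * int k" using assms [of p] by (metis dvdE mult.commute)
  have "red_pair (\<lambda>a. int k * unit_vec i a) (unit_vec j) \<in> C.wedge_kernel"
    unfolding reduce_multiple
    by (rule C.bilinear_one_left [where t = "\<lambda>x y. frag_of (x, y)", OF W.difference_closed_axioms
        C.wedge_kernel_bilinear reduce_closed])
  from W.diff_mem [OF this additive_multiple [where f = "\<lambda>u. red_pair u (unit_vec j)"
      and m = "int k" and u = "unit_vec i", OF W.difference_closed_axioms red_pair_add(1)]]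
  have "frag_cmul (int k) (red_pair (unit_vec i) (unit_vec j)) \<in> C.wedge_kernel" by simp
  from frag_cmul_mem [OF W.difference_closed_axioms this, of q]
  show "frag_cmul (Poly_Mapping.lookup m p) (case p of (i, j) \<Rightarrow> red_pair (unit_vec i) (unit_vec j)) \<in> C.wedge_kernel"
    using p q by simp
qed

lemma coordinates_outside: "\<not> (i < j \<and> j < n) \<Longrightarrow> Poly_Mapping.lookup (coordinates z) (i, j) = 0"
proof -
  assume *: "\<not> (i < j \<and> j < n)"
  have "Poly_Mapping.keys z \<subseteq> UNIV" by simp
  then show ?thesis
  proof (induction z rule: frag_induction)
    case (one p)
    then show ?case using * by (cases p) (auto simp: coordinates_def lookup_minors)
  qed (simp_all add: coordinates_def frag_extend_diff lookup_minus)
qed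

text \<open>The minors are bilinear and alternating modulo \<open>k\<close>, so the universal
  property applies with the multiples of \<open>k\<close> as \<open>K\<close>.\<close>

lemma coordinates_wedge_kernel:
  assumes "z \<in> C.wedge_kernel"
  shows "int k dvd Poly_Mapping.lookup (coordinates z) p"
proof -
  let ?L = "{m :: nat \<times> nat \<Rightarrow>\<^sub>0 int. \<forall>p. int k dvd Poly_Mapping.lookup m p}"
  \<comment> \<open>Products in the group reduce each entry modulo \<open>k\<close>; this bounds the
    effect on a minor to a multiple of \<open>k\<close>.\<close>
  have dvd: "int k dvd ((a + b) mod int k * d - (a' + b') mod int k * d' - (a * d - a' * d') - (b * d - b' * d'))"
    for a b d a' b' d' :: int
  proof -
    have "int k dvd c mod int k - c" for c by (simp add: mod_eq_dvd_iff [symmetric])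
    then have "int k dvd ((a + b) mod int k - (a + b)) * d - ((a' + b') mod int k - (a' + b')) * d'"
      by (intro dvd_diff [OF dvd_mult2 dvd_mult2])
    then show ?thesis by (simp add: algebra_simps)
  qed
  have "coordinates z \<in> ?L"
    unfolding coordinates_def
  proof (rule C.wedge_kernel_universal [OF difference_closed_dvd _ _ _ assms], goal_cases)
    case (1 x y w)
    have "int k dvd Poly_Mapping.lookup (minors n (x \<otimes>\<^bsub>cyclic_power k n\<^esub> y, w)
        - minors n (x, w) - minors n (y, w)) (i, j)" for i j
      using dvd [of "x i" "y i" "w j" "x j" "y j" "w i"]
      by (simp add: lookup_minus lookup_minors mult_cyclic_power)
    then show ?case by simp
  next
    case (2 x y w)
    have "int k dvd Poly_Mapping.lookup (minors n (x, y \<otimes>\<^bsub>cyclic_power k n\<^esub> w)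
        - minors n (x, y) - minors n (x, w)) (i, j)" for i j
      using dvd [of "y j" "w j" "x i" "y i" "w i" "x j"]
      by (simp add: lookup_minus lookup_minors mult_cyclic_power mult.commute)
    then show ?case by simp
  next
    case (3 x)
    have "int k dvd Poly_Mapping.lookup (minors n (x, x)) (i, j)" for i j by (simp add: lookup_minors)
    then show ?case by simp
  qed
  then show ?thesis by blast
qed

text \<open>The minors of two unit vectors form a single unit entry. Equality holds only modulo
  \<open>k\<close>: for \<open>k = 1\<close> the reduced unit vectors are 0.\<close>

lemma coordinates_basis_wedge:
  assumes "Poly_Mapping.keys m \<subseteq> {(i, j). i < j \<and> j < n}"
  shows "int k dvd Poly_Mapping.lookup (coordinates (basis_wedge m) - m) p"
  using assms
proof (induction m rule: frag_induction)
  case (one q)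
  obtain a b i j where p: "p = (a, b)" and q: "q = (i, j)" by fastforce
  have ij: "i < j" "j < n" using one q by auto
  have "int k dvd ((x mod int k) * (y mod int k) - (z mod int k) * (w mod int k)) - (x * y - z * w)" for x y z w
    unfolding mod_eq_dvd_iff [symmetric] by (intro mod_diff_cong) (simp_all add: mod_mult_eq)
  from this [of "unit_vec i a" "unit_vec j b" "unit_vec i b" "unit_vec j a"] ij show ?case
    by (auto simp: p q basis_wedge_def coordinates_def lookup_minus lookup_minors reduce_def unit_vec_def
        when_def split: if_splits)
next
  case (diff x y)
  from dvd_diff [OF this] show ?case
    by (simp add: coordinates_def basis_wedge_def frag_extend_diff lookup_minus lookup_add algebra_simps)
qed (simp add: coordinates_def basis_wedge_def)

text \<open>The coordinates modulo \<open>k\<close> map onto the power of the cyclic group. An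
  element with all coordinates divisible by \<open>k\<close> is a relation, because it agrees with
  the basis wedge of its coordinates; so the kernel is that of the projection.\<close>

lemma exterior_square_cyclic_power: "exterior_square (cyclic_power k n) \<cong> cyclic_power k (n choose 2)"
proof -
  let ?N = "n choose 2" and ?P = "{(i, j). i < j \<and> j < n}"
  \<comment> \<open>The target numbers its coordinates below \<open>?N\<close>, so the pairs
    \<open>i < j\<close> are enumerated.\<close>
  obtain q where q: "bij_betw q {..<?N} ?P"
    using ex_bij_betw_nat_finite [OF card_ordered_pairs(1) [of n]] card_ordered_pairs(2) [of n]
    by (auto simp: atLeast0LessThan)
  define p where "p z = (\<lambda>s\<in>{..<?N}. Poly_Mapping.lookup (coordinates z) (q s) mod int k)" for z
  show ?thesis
  proof (rule iso_of_same_kernel [where f = "wedge_proj (cyclic_power k n)" and g = p])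
    show "wedge_proj (cyclic_power k n) \<in> hom C.pair_group (exterior_square (cyclic_power k n))"
      by (rule C.wedge_proj_hom)
    show "wedge_proj (cyclic_power k n) ` carrier C.pair_group = carrier (exterior_square (cyclic_power k n))"
      by (rule C.wedge_proj_surj)
    show "group C.pair_group" by simp
    show "group (exterior_square (cyclic_power k n))" by (rule C.group_exterior_square)
    show "group (cyclic_power k ?N)" by (rule comm_group.axioms(2) [OF comm_group_cyclic_power])
    have carr: "carrier (cyclic_power k ?N) = (\<Pi>\<^sub>E i\<in>{..<?N}. {0..<int k})"
      using k by (simp add: cyclic_power_def carrier_integer_mod_group)
    show p: "p \<in> hom C.pair_group (cyclic_power k ?N)"
    proof (rule homI)
      fix x show "p x \<in> carrier (cyclic_power k ?N)" using k by (simp add: carr p_def)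
    next
      fix x y show "p (x \<otimes>\<^bsub>C.pair_group\<^esub> y) = p x \<otimes>\<^bsub>cyclic_power k ?N\<^esub> p y"
        by (simp add: p_def cyclic_power_def fun_eq_iff coordinates_def frag_extend_add lookup_add mod_add_eq)
    qed
    have "v \<in> p ` carrier C.pair_group" if v: "v \<in> carrier (cyclic_power k ?N)" for v
    proof
      \<comment> \<open>The element \<open>m\<close> has the entry \<open>v s\<close> at
        \<open>q s\<close>. Its basis wedge is a preimage of \<open>v\<close>, since its coordinates
        agree with \<open>m\<close> modulo \<open>k\<close>.\<close>
      define m where "m = (\<Sum>s<?N. frag_cmul (v s) (frag_of (q s)))"
      have "m \<in> carrier (free_Abelian_group ?P)"
        unfolding m_def
      proof (rule sum_closed_free_Abelian_group)
        fix s assume "s \<in> {..<?N}"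
        then have "q s \<in> ?P" by (rule bij_betw_apply [OF q])
        then show "frag_cmul (v s) (frag_of (q s)) \<in> carrier (free_Abelian_group ?P)"
          unfolding carrier_free_Abelian_group_iff by (intro order.trans [OF keys_cmul]) simp
      qed
      then have keys: "Poly_Mapping.keys m \<subseteq> ?P" by simp
      have "Poly_Mapping.lookup m (q s) = v s" if "s < ?N" for s
      proof -
        have "Poly_Mapping.lookup m (q s) = (\<Sum>s'<?N. if s' = s then v s' else 0)"
          unfolding m_def lookup_sum using q that
          by (intro sum.cong refl) (auto simp: bij_betw_def inj_on_def when_def)
        with that show ?thesis by simp
      qed
      moreover have "Poly_Mapping.lookup (coordinates (basis_wedge m)) r mod int k = Poly_Mapping.lookup m r mod int k" for r
        using coordinates_basis_wedge [OF keys, of r] by (simp add: lookup_minus mod_eq_dvd_iff)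
      ultimately show "v = p (basis_wedge m)"
        using v by (auto simp: p_def fun_eq_iff carr PiE_iff extensional_def)
      show "basis_wedge m \<in> carrier C.pair_group"
        using keys_frag_extend [of "\<lambda>(i, j). red_pair (unit_vec i) (unit_vec j)" m] reduce_closed
        by (fastforce simp: basis_wedge_def)
    qed
    then show "p ` carrier C.pair_group = carrier (cyclic_power k ?N)"
      using hom_carrier [OF p] by blast
    have "p z = \<one>\<^bsub>cyclic_power k ?N\<^esub> \<longleftrightarrow> z \<in> C.wedge_kernel" if z: "z \<in> carrier C.pair_group" for z
    proof -
      have "p z = \<one>\<^bsub>cyclic_power k ?N\<^esub> \<longleftrightarrow> (\<forall>s<?N. int k dvd Poly_Mapping.lookup (coordinates z) (q s))"
        by (auto simp: p_def cyclic_power_def fun_eq_iff dvd_eq_mod_eq_0)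
      also have "\<dots> \<longleftrightarrow> (\<forall>r\<in>?P. int k dvd Poly_Mapping.lookup (coordinates z) r)"
        using bij_betw_imp_surj_on [OF q, symmetric] by auto
      also have "\<dots> \<longleftrightarrow> (\<forall>r. int k dvd Poly_Mapping.lookup (coordinates z) r)"
      proof
        assume *: "\<forall>r\<in>?P. int k dvd Poly_Mapping.lookup (coordinates z) r"
        show "\<forall>r. int k dvd Poly_Mapping.lookup (coordinates z) r"
        proof
          fix r :: "nat \<times> nat"
          obtain i j where r: "r = (i, j)" by fastforce
          show "int k dvd Poly_Mapping.lookup (coordinates z) r"
            using * coordinates_outside [of i j z] unfolding r by (cases "i < j \<and> j < n") auto
        qed
      qed blast
      also have "\<dots> \<longleftrightarrow> z \<in> C.wedge_kernel"
      proof
        assume "\<forall>r. int k dvd Poly_Mapping.lookup (coordinates z) r"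
        then have "basis_wedge (coordinates z) \<in> C.wedge_kernel" by (intro basis_wedge_dvd) blast
        from W.add_mem [OF basis_wedge_coordinates [OF z] this] show "z \<in> C.wedge_kernel" by simp
      qed (use coordinates_wedge_kernel in blast)
      finally show ?thesis .
    qed
    then show "C.wedge_kernel = kernel C.pair_group (cyclic_power k ?N) p"
      by (auto simp: kernel_def)
  qed
qed

end

section \<open>Conclusion for groups of odd order and for cyclic powers\<close>

lemma odd_abelian_group_cyclic_power:
  assumes "odd k" shows "odd_abelian_group (cyclic_power k n)"
proof -
  have k: "k > 0" using assms by (rule odd_pos)
  then have "order (cyclic_power k n) = k ^ n" by (rule order_cyclic_power)
  \<comment> \<open>An infinite carrier would have \<open>order\<close> 0, whereas
    \<open>k ^ n\<close> is positive.\<close>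
  moreover from this k have "finite (carrier (cyclic_power k n))"
    by (metis card.infinite order_def power_not_zero not_gr_zero)
  ultimately show ?thesis
    using assms by (simp add: odd_abelian_group_def odd_abelian_group_axioms_def comm_group_cyclic_power)
qed

theorem theorem1p1:
  fixes G :: "('a, 'b) monoid_scheme"
  assumes "comm_group G" and "finite (carrier G)" and "odd (order G)"
  shows "quandle_homology 2 (takasaki G) \<cong> exterior_square G \<and>
    (\<forall>k n :: nat. odd k \<longrightarrow> n \<ge> 1 \<longrightarrow>
      quandle_homology 2 (takasaki (cyclic_power k n)) \<cong> cyclic_power k (n choose 2))"
proof (intro conjI allI impI)
  show "quandle_homology 2 (takasaki G) \<cong> exterior_square G"
    using assms by (intro odd_abelian_group.homology_2_takasaki)
      (simp add: odd_abelian_group_def odd_abelian_group_axioms_def)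
  fix k n :: nat
  assume "odd k"
  then have "quandle_homology 2 (takasaki (cyclic_power k n)) \<cong> exterior_square (cyclic_power k n)"
    by (intro odd_abelian_group.homology_2_takasaki odd_abelian_group_cyclic_power)
  also have "exterior_square (cyclic_power k n) \<cong> cyclic_power k (n choose 2)"
    using \<open>odd k\<close> by (intro exterior_square_cyclic_power odd_pos)
  finally (iso_trans)
  show "quandle_homology 2 (takasaki (cyclic_power k n)) \<cong> cyclic_power k (n choose 2)" .
qed

end
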